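(* Let $0<c<1$ be fixed, let $p\in[0,1]$, and let $m=cn$ (with $n$ ranging over positive integers such that $cn$ is an integer). For a preference list $\alpha=(a_1,\ldots,a_m)\in[n]^m$ chosen uniformly at random, with the $m$ cars parking on $n$ spots under the probabilistic parking protocol with parameter $p$, we have, as $n\to\infty$, $$\mathbb{E}(a_m\mid\alpha\in\mathrm{PF}_{m,n})=\frac{n+1}{2}-(2p-1)\frac{c}{2(1-c)}-\frac1n(2p-1)\frac{c^2-c-1}{2(1-c)^3}+O(n^{-2}).$$
   Context: $[n]=\{1,\ldots,n\}$. Probabilistic parking protocol with parameter $p\in[0,1]$: there are $m$ cars and a one-way street with $n\ge m$ spots numbered $1,\ldots,n$. Cars $1,\ldots,m$ arrive in order; car $i$ has preference $a_i\in[n]$ and first goes to spot $a_i$. If spot $a_i$ is unoccupied, the car parks there. If it is occupied, the driver tosses (once) a biased coin, independent of everything else: with probability $p$ the car moves forward and parks in the first unoccupied spot with number greater than $a_i$, if one exists; with probability $1-p$ the car moves backward and parks in the first unoccupied spot encountered (the largest unoccupied number less than $a_i$), if one exists. If there is no unoccupied spot in the chosen direction, the car fails to park. "$\alpha\in\mathrm{PF}_{m,n}$" denotes the event that all $m$ cars with preference list $\alpha$ succeed in parking; probabilities and expectations are over both the uniform choice of $\alpha\in[n]^m$ and the coin tosses. *)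

theory Defs
  imports "HOL-Probability.Probability" "HOL-Library.Landau_Symbols"
begin

text \<open>
  The street has spots \<open>{1..n}\<close>, and \<open>S\<close> denotes the set of occupied spots. \<open>None\<close> means that
  the car fails to park.
\<close>

definition next_free :: "nat \<Rightarrow> nat set \<Rightarrow> nat \<Rightarrow> nat option" where
  "next_free n S a = (if {a<..n} - S = {} then None else Some (Min ({a<..n} - S)))"

definition prev_free :: "nat set \<Rightarrow> nat \<Rightarrow> nat option" where
  "prev_free S a = (if {1..<a} - S = {} then None else Some (Max ({1..<a} - S)))"

definition park_car :: "nat \<Rightarrow> real \<Rightarrow> nat set \<Rightarrow> nat \<Rightarrow> nat option pmf" where
  "park_car n p S a =
     (if a \<notin> S then return_pmf (Some a)
      else map_pmf (\<lambda>forward. if forward then next_free n S a else prev_free S a)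
             (bernoulli_pmf p))"

text \<open>
  The result lists, car by car, the spot taken by each car. A car that fails to park leaves, and
  the cars after it still try to park.
\<close>

fun park_cars :: "nat \<Rightarrow> real \<Rightarrow> nat set \<Rightarrow> nat list \<Rightarrow> nat option list pmf" where
  "park_cars n p S [] = return_pmf []"
| "park_cars n p S (a # as) =
     do {
       s \<leftarrow> park_car n p S a;
       ss \<leftarrow> park_cars n p (S \<union> set_option s) as;
       return_pmf (s # ss)
     }"

definition preference_lists :: "nat \<Rightarrow> nat \<Rightarrow> nat list set" where
  "preference_lists m n = {\<alpha>. length \<alpha> = m \<and> set \<alpha> \<subseteq> {1..n}}"

text \<open>Joint law of the uniform preference list and the outcome of the coin tosses.\<close>

definition parking_pmf :: "nat \<Rightarrow> nat \<Rightarrow> real \<Rightarrow> (nat list \<times> nat option list) pmf" where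
  "parking_pmf m n p =
     do {
       \<alpha> \<leftarrow> pmf_of_set (preference_lists m n);
       ss \<leftarrow> park_cars n p {} \<alpha>;
       return_pmf (\<alpha>, ss)
     }"

definition all_parked :: "(nat list \<times> nat option list) set" where
  "all_parked = {(\<alpha>, ss). None \<notin> set ss}"

text \<open>The preference of car \<open>m\<close> is at index \<open>m - 1\<close>, as lists are indexed from \<open>0\<close>.\<close>

definition expected_last_preference :: "nat \<Rightarrow> nat \<Rightarrow> real \<Rightarrow> real" where
  "expected_last_preference m n p =
     measure_pmf.expectation (cond_pmf (parking_pmf m n p) all_parked)
       (\<lambda>(\<alpha>, ss). real (\<alpha> ! (m - 1)))"

text \<open>
  The constant \<^const>\<open>cond_pmf\<close> is only meaningful if the conditioning event meets the support.
  This holds whenever \<open>m \<le> n\<close>: if the preferences are distinct, all cars park.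
\<close>

lemma park_cars_distinct:
  assumes "distinct \<alpha>" "set \<alpha> \<inter> S = {}"
  shows "park_cars n p S \<alpha> = return_pmf (map Some \<alpha>)"
  using assms by (induction \<alpha> arbitrary: S) (auto simp: park_car_def bind_return_pmf)

lemma parking_pmf_all_parked:
  assumes "m \<le> n"
  shows "set_pmf (parking_pmf m n p) \<inter> all_parked \<noteq> {}"
proof -
  let ?\<alpha> = "[1..<Suc m]"
  have mem: "?\<alpha> \<in> preference_lists m n"
    using assms by (auto simp: preference_lists_def)
  have fin: "finite (preference_lists m n)"
    using finite_lists_length_eq[of "{1..n}" m] by (simp add: preference_lists_def conj_commute)
  have "park_cars n p {} ?\<alpha> = return_pmf (map Some ?\<alpha>)"
    by (rule park_cars_distinct) auto
  hence "(?\<alpha>, map Some ?\<alpha>) \<in> set_pmf (parking_pmf m n p)"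
    using mem fin unfolding parking_pmf_def
    by (subst set_bind_pmf, subst set_pmf_of_set) (auto intro!: bexI[of _ ?\<alpha>] simp del: upt_Suc)
  thus ?thesis by (auto simp: all_parked_def)
qed

end

theory Submission
  imports Defs "HOL-Real_Asymp.Real_Asymp"
begin

text \<open>
  Condition on the set \<open>T\<close> occupied by the first \<open>M = m - 1\<close> cars. The last car, with preference \<open>a\<close>, fails
  only if it moves forward while all spots from \<open>a\<close> to \<open>n\<close> are taken, or moves backward while all
  spots from \<open>1\<close> to \<open>a\<close> are taken. The last preference is therefore uniform except for a loss of mass \<open>p\<close>
  on the trailing run of \<open>T\<close> and of mass \<open>1 - p\<close> on its leading run. Its first moment depends
  on \<open>T\<close> only through the lengths of these runs and their squares.

  The law of the run lengths is explicit. Cars on the two sides of a spot that stays free do not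
  interact (\<open>occupation_weight_separated\<close>). So the weight of all outcomes with leading run \<open>k\<close> is
  a binomial coefficient times the total weight of filling \<open>k\<close> spots with \<open>k\<close> cars times the total
  weight of \<open>M - k\<close> cars on the remaining \<open>n - k - 1\<close> spots (\<open>sum_by_end_run\<close>), and likewise for the
  trailing run. The total weights do not depend on \<open>p\<close>: they are the classical parking numbers
  \<open>(n + 1 - m) (n + 1)\<^bsup>m - 1\<^esup>\<close>. This follows by induction on the number of cars, as the loss caused by one
  more car is governed by the run lengths of the previous ones (\<open>total_weight_interval\<close>).

  Both moments are then Abel sums. The first is evaluated by Abel's identity (\<open>abel_binomial\<close>), and
  the second satisfies a recursion that turns it into a sum over falling factorials
  (\<open>abel_binomial_succ_power\<close>). With \<open>z = n + 1\<close> and \<open>N = M - 1\<close> this gives, for \<open>2 \<le> m \<le> n\<close>, the exact value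
  (\<open>expected_last_preference_exact\<close>)

  \<open>(n + 1) / 2 - (2 p - 1) M / (2 (n - M)) (1 - s / z)\<close>,

  where \<open>s\<close> is the sum over \<open>i \<le> N\<close> of \<open>(2 + i) N (N - 1) \<cdots> (N - i + 1) / z ^ i\<close>. For
  \<open>m = c n\<close> the summands tend to \<open>(2 + i) c ^ i\<close>, and \<open>s\<close> differs from \<open>(2 - c) / (1 - c)\<^sup>2\<close> by \<open>O(1 / n)\<close>.
  As \<open>s\<close> is divided by \<open>z\<close>, this precision suffices, and a rational function of \<open>n\<close> remains to be expanded.
\<close>

section \<open>Abel's binomial identity\<close>

text \<open>
  Absorption, \<open>k (N+1 choose k) = (N+1) (N choose k-1)\<close>, trades a factor \<open>k\<close> for a lower row of Pascal's
  triangle. It is the step by which the sums below are reduced to shorter ones.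
\<close>

lemma sum_binomial_absorb:
  fixes g :: "nat \<Rightarrow> real"
  shows "(\<Sum>k\<le>Suc N. real k * real (Suc N choose k) * g k)
       = real (Suc N) * (\<Sum>j\<le>N. real (N choose j) * g (Suc j))"
proof -
  have "(\<Sum>k\<le>Suc N. real k * real (Suc N choose k) * g k)
      = (\<Sum>j\<le>N. real (Suc j) * real (Suc N choose Suc j) * g (Suc j))"
    by (subst sum.atMost_Suc_shift) simp
  also have "\<dots> = (\<Sum>j\<le>N. real (Suc N) * (real (N choose j) * g (Suc j)))"
  proof (rule sum.cong[OF refl])
    fix j
    have "real (Suc j) * real (Suc N choose Suc j) = real (Suc N) * real (N choose j)"
      by (metis Suc_times_binomial_eq mult.commute of_nat_mult)
    thus "real (Suc j) * real (Suc N choose Suc j) * g (Suc j)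
        = real (Suc N) * (real (N choose j) * g (Suc j))" by simp
  qed
  finally show ?thesis by (simp add: sum_distrib_left)
qed

text \<open>
  A \<open>q\<close>-th finite difference annihilates polynomials of degree below \<open>q\<close>. One factor
  \<open>a - t\<close> is split off: the part \<open>a\<close> lowers the degree, and the part \<open>t\<close> lowers degree and
  order together by absorption.
\<close>

lemma alternating_binomial_power_sum_zero:
  fixes a :: real
  assumes "d < q"
  shows "(\<Sum>t\<le>q. (-1) ^ t * real (q choose t) * (a - real t) ^ d) = 0"
  using assms
proof (induction d arbitrary: q a)
  case 0
  thus ?case using choose_alternating_sum[of q, where 'a = real] by simp
next
  case (Suc d)
  then obtain r where q: "q = Suc r" and r: "d < r" by (cases q) auto
  have "(\<Sum>t\<le>q. (-1) ^ t * real (q choose t) * (a - real t) ^ Suc d)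
      = a * (\<Sum>t\<le>q. (-1) ^ t * real (q choose t) * (a - real t) ^ d)
        - (\<Sum>t\<le>Suc r. real t * real (Suc r choose t) * ((-1) ^ t * (a - real t) ^ d))"
    unfolding sum_distrib_left q sum_subtractf[symmetric]
    by (intro sum.cong refl) (simp add: algebra_simps)
  also have "(\<Sum>t\<le>Suc r. real t * real (Suc r choose t) * ((-1) ^ t * (a - real t) ^ d))
      = - real (Suc r) * (\<Sum>t\<le>r. (-1) ^ t * real (r choose t) * ((a - 1) - real t) ^ d)"
    unfolding sum_binomial_absorb sum_distrib_left
    by (intro sum.cong refl) (simp add: algebra_simps)
  also have "\<dots> = 0" using Suc.IH[OF r, of "a - 1"] by simp
  also have "(\<Sum>t\<le>q. (-1) ^ t * real (q choose t) * (a - real t) ^ d) = 0"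
    using Suc.IH[of q a] Suc.prems by simp
  finally show ?case by simp
qed

text \<open>
  The factor \<open>y (y + k)\<^bsup>k - 1\<^esup>\<close> of Abel's identity. The quotient gives it the value \<open>1\<close> at
  \<open>k = 0\<close> (for \<open>y \<noteq> 0\<close>), where the exponent would be \<open>-1\<close>.
\<close>

definition abel_kernel :: "real \<Rightarrow> nat \<Rightarrow> real" where
  "abel_kernel y k = y * (y + real k) ^ k / (y + real k)"

text \<open>
  Abel's generalisation of the binomial theorem. Put \<open>z = x + y + N\<close>, so that
  \<open>x + j = z - (y + N - j)\<close>, and expand the power of \<open>x + j\<close> in powers of \<open>z\<close>. The coefficient
  of \<open>z ^ i\<close> is then an \<open>(N - i)\<close>-th difference of a polynomial of degree \<open>N - i - 1\<close>, so only
  \<open>i = N\<close> survives.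
\<close>

lemma abel_binomial:
  fixes x y :: real
  assumes y: "y > 0"
  shows "(\<Sum>j\<le>N. real (N choose j) * (x + real j) ^ j * abel_kernel y (N - j))
       = (x + y + real N) ^ N"
proof -
  define z where "z = x + y + real N"
  define f where "f i t = real (N choose i) * z ^ i * (y *
      ((-1) ^ t * real ((N - i) choose t) * ((y + real (N - i)) - real t) ^ (N - i)
        / ((y + real (N - i)) - real t)))" for i t
  have "(\<Sum>j\<le>N. real (N choose j) * (x + real j) ^ j * abel_kernel y (N - j))
      = (\<Sum>j\<le>N. \<Sum>i\<le>j. f i (j - i))"
  proof (rule sum.cong[OF refl])
    fix j assume "j \<in> {..N}"
    hence j: "j \<le> N" by simp
    define w where "w = y + real (N - j)"
    have "(x + real j) ^ j = (z + - w) ^ j"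
      using j by (simp add: z_def w_def of_nat_diff)
    also have "\<dots> = (\<Sum>i\<le>j. real (j choose i) * z ^ i * (- w) ^ (j - i))"
      by (simp only: binomial_ring)
    finally have "real (N choose j) * (x + real j) ^ j * abel_kernel y (N - j)
        = (\<Sum>i\<le>j. real (N choose j) * (real (j choose i) * z ^ i * (- w) ^ (j - i)) *
             (y * w ^ (N - j) / w))"
      unfolding abel_kernel_def w_def[symmetric]
      by (simp only: sum_distrib_left sum_distrib_right)
    also have "\<dots> = (\<Sum>i\<le>j. f i (j - i))"
    proof (rule sum.cong[OF refl])
      fix i assume "i \<in> {..j}"
      hence i: "i \<le> j" by simp
      have c: "real (N choose j) * real (j choose i)
             = real (N choose i) * real ((N - i) choose (j - i))"
        using choose_mult[OF i j] by (metis of_nat_mult)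
      have w': "(y + real (N - i)) - real (j - i) = w"
        using i j by (simp add: w_def of_nat_diff)
      have e: "(- w) ^ (j - i) * w ^ (N - j) = (-1) ^ (j - i) * w ^ (N - i)"
      proof -
        have "w ^ (N - i) = w ^ (j - i) * w ^ (N - j)"
          using i j by (simp add: power_add[symmetric])
        thus ?thesis by (simp add: power_minus[of w])
      qed
      have "real (N choose j) * (real (j choose i) * z ^ i * (- w) ^ (j - i)) * (y * w ^ (N - j) / w)
          = (real (N choose j) * real (j choose i)) * z ^ i *
              (y * (((- w) ^ (j - i) * w ^ (N - j)) / w))"
        by simp
      also have "\<dots> = f i (j - i)"
        unfolding c e f_def w' by simp
      finally show "real (N choose j) * (real (j choose i) * z ^ i * (- w) ^ (j - i)) *
          (y * w ^ (N - j) / w) = f i (j - i)" .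
    qed
    finally show "real (N choose j) * (x + real j) ^ j * abel_kernel y (N - j)
      = (\<Sum>i\<le>j. f i (j - i))" .
  qed
  \<comment> \<open>Collect the powers of \<open>z\<close>: the inner sum now runs over \<open>t = j - i\<close> for fixed \<open>i\<close>.\<close>
  also have "\<dots> = (\<Sum>(i,t)\<in>{(i,t). i + t \<le> N}. f i t)"
    by (rule sum.triangle_reindex_eq[symmetric])
  also have "{(i,t). i + t \<le> N} = Sigma {..N} (\<lambda>i. {..N - i})" by auto
  also have "(\<Sum>(i,t)\<in>Sigma {..N} (\<lambda>i. {..N - i}). f i t) = (\<Sum>i\<le>N. \<Sum>t\<le>N - i. f i t)"
    by (subst sum.Sigma) auto
  also have "\<dots> = (\<Sum>i\<le>N. if i = N then z ^ N else 0)"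
  proof (rule sum.cong[OF refl])
    fix i assume "i \<in> {..N}"
    hence i: "i \<le> N" by simp
    show "(\<Sum>t\<le>N - i. f i t) = (if i = N then z ^ N else 0)"
    proof (cases "i = N")
      case True thus ?thesis using y by (simp add: f_def)
    next
      case False
      then obtain r where r: "N - i = Suc r" using i by (metis Suc_diff_Suc le_neq_implies_less)
      have "(\<Sum>t\<le>N - i. f i t) = real (N choose i) * z ^ i * (y *
         (\<Sum>t\<le>N - i. (-1) ^ t * real ((N - i) choose t) * ((y + real (N - i)) - real t) ^ r))"
        unfolding sum_distrib_left
      proof (rule sum.cong[OF refl])
        fix t assume "t \<in> {..N - i}"
        hence "(y + real (N - i)) - real t > 0" using y by auto
        thus "f i t = real (N choose i) * z ^ i * (y *
          ((-1) ^ t * real ((N - i) choose t) * ((y + real (N - i)) - real t) ^ r))"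
          unfolding f_def r by simp
      qed
      also have "\<dots> = 0"
        using alternating_binomial_power_sum_zero[of r "N - i" "y + real (N - i)"] r by simp
      finally show ?thesis using False by simp
    qed
  qed
  also have "\<dots> = z ^ N" by simp
  finally show ?thesis unfolding z_def .
qed

text \<open>
  Splitting the extra power of \<open>x + j\<close> into \<open>x\<close> and \<open>j\<close> gives Abel's identity for the part \<open>x\<close> and,
  by absorption, the same sum for \<open>N - 1\<close> and \<open>x + 1\<close> for the part \<open>j\<close>.
  As \<open>z = x + y + N\<close> does not change in this step, iteration produces a sum over falling factorials
  of \<open>N\<close> divided by powers of \<open>z\<close>. In this form the limit for large \<open>z\<close> can be read off term by term.
\<close>

lemma abel_binomial_succ_power:
  fixes x y :: real
  assumes y: "y > 0" and z: "z > 0" "z = x + y + real N"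
  shows "(\<Sum>j\<le>N. real (N choose j) * (x + real j) ^ Suc j * abel_kernel y (N - j))
       = z ^ N * (\<Sum>i\<le>N. (\<Prod>t<i. (real N - real t) / z) * (x + real i))"
  using z(2)
proof (induction N arbitrary: x)
  case 0
  thus ?case using y by (simp add: abel_kernel_def)
next
  case (Suc N)
  have z': "z = (x + 1) + y + real N" using Suc.prems by simp
  have "(\<Sum>j\<le>Suc N. real (Suc N choose j) * (x + real j) ^ Suc j * abel_kernel y (Suc N - j))
     = x * (\<Sum>j\<le>Suc N. real (Suc N choose j) * (x + real j) ^ j * abel_kernel y (Suc N - j))
       + (\<Sum>j\<le>Suc N. real j * real (Suc N choose j) *
            ((x + real j) ^ j * abel_kernel y (Suc N - j)))"
    unfolding sum_distrib_left sum.distrib[symmetric]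
    by (intro sum.cong refl) (simp add: algebra_simps)
  also have "(\<Sum>j\<le>Suc N. real (Suc N choose j) * (x + real j) ^ j * abel_kernel y (Suc N - j))
     = z ^ Suc N"
    unfolding Suc.prems by (rule abel_binomial[OF y])
  also have "(\<Sum>j\<le>Suc N. real j * real (Suc N choose j) *
            ((x + real j) ^ j * abel_kernel y (Suc N - j)))
     = real (Suc N) * (\<Sum>j\<le>N. real (N choose j) * (x + 1 + real j) ^ Suc j * abel_kernel y (N - j))"
    unfolding sum_binomial_absorb by (simp add: algebra_simps)
  also have "\<dots> = real (Suc N) * (z ^ N *
      (\<Sum>i\<le>N. (\<Prod>t<i. (real N - real t) / z) * (x + 1 + real i)))"
    using Suc.IH[OF z'] by simp
  also have "x * z ^ Suc N + \<dots> = z ^ Suc N * (x + (\<Sum>i\<le>N. (real (Suc N) / z *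
      (\<Prod>t<i. (real N - real t) / z)) * (x + 1 + real i)))"
  proof -
    have "(\<Sum>i\<le>N. (real (Suc N) / z * (\<Prod>t<i. (real N - real t) / z)) * (x + 1 + real i))
        = real (Suc N) / z * (\<Sum>i\<le>N. (\<Prod>t<i. (real N - real t) / z) * (x + 1 + real i))"
      by (simp only: sum_distrib_left mult.assoc)
    thus ?thesis using z(1) by (simp only: power_Suc) (simp add: field_simps)
  qed
  also have "(x + (\<Sum>i\<le>N. (real (Suc N) / z *
      (\<Prod>t<i. (real N - real t) / z)) * (x + 1 + real i)))
     = (\<Sum>i\<le>Suc N. (\<Prod>t<i. (real (Suc N) - real t) / z) * (x + real i))"
    by (subst sum.atMost_Suc_shift, subst prod.lessThan_Suc_shift) (simp add: add_ac)
  finally show ?case .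
qed

text \<open>
  The number \<open>(n + 1 - m) (n + 1)\<^bsup>m - 1\<^esup>\<close> of classical parking functions with \<open>m\<close> cars and \<open>n\<close> spots,
  written so that \<open>m = 0\<close> is covered.
\<close>

definition parking_number :: "nat \<Rightarrow> nat \<Rightarrow> real" where
  "parking_number m n = (real n + 1 - real m) * (real n + 1) ^ m / (real n + 1)"

lemma parking_number_split:
  assumes "k \<le> m" "m < n"
  shows "parking_number k k = (1 + real k) ^ k / (1 + real k)"
    and "parking_number (m - k) (n - Suc k) = abel_kernel (real n - real m) (m - k)"
  using assms by (auto simp: parking_number_def abel_kernel_def of_nat_diff add_ac)

text \<open>
  The summand counts, weighted by \<open>k\<close>, the outcomes in which the first \<open>k\<close> spots are
  taken and the next one is free (see \<open>sum_by_leading_run\<close> below). Absorbing \<open>k\<close> leaves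
  Abel's sum with \<open>x = 2\<close> and \<open>y = n - m\<close>.
\<close>

lemma sum_run_length:
  assumes "m < n"
  shows "(\<Sum>k\<le>m. real (m choose k) * parking_number k k * parking_number (m - k) (n - Suc k) * real k)
       = real m * (real n + 1) ^ m / (real n + 1)"
proof (cases m)
  case 0
  thus ?thesis by simp
next
  case (Suc N)
  define y where "y = real n - real m"
  have y: "y > 0" using assms by (simp add: y_def)
  note split = parking_number_split[OF _ assms, folded y_def, unfolded Suc]
  have "(\<Sum>k\<le>m. real (m choose k) * parking_number k k * parking_number (m - k) (n - Suc k) * real k)
     = (\<Sum>k\<le>Suc N. real k * real (Suc N choose k) *
          ((1 + real k) ^ k / (1 + real k) * abel_kernel y (Suc N - k)))"
    unfolding Suc by (intro sum.cong) (auto simp: split)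
  also have "\<dots> = real (Suc N) * (\<Sum>j\<le>N. real (N choose j) * (2 + real j) ^ j * abel_kernel y (N - j))"
  proof -
    have "(1 + real (Suc j)) ^ Suc j / (1 + real (Suc j)) = (2 + real j) ^ j" for j
      by (simp add: field_simps)
    thus ?thesis unfolding sum_binomial_absorb by (simp add: mult.assoc)
  qed
  also have "\<dots> = real (Suc N) * (real n + 1) ^ N"
    unfolding abel_binomial[OF y] using Suc by (simp add: y_def add_ac)
  finally show ?thesis using Suc by simp
qed

lemma sum_run_length_triangular:
  assumes "Suc N < n"
  shows "(\<Sum>k\<le>Suc N. real (Suc N choose k) * parking_number k k *
            parking_number (Suc N - k) (n - Suc k) * (real k * (real k + 1) / 2))
       = real (Suc N) / 2 * ((real n + 1) ^ N *
            (\<Sum>i\<le>N. (\<Prod>t<i. (real N - real t) / (real n + 1)) * (2 + real i)))"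
proof -
  define y where "y = real n - real (Suc N)"
  have y: "y > 0" using assms by (simp add: y_def)
  note split = parking_number_split[OF _ assms, folded y_def]
  have "(\<Sum>k\<le>Suc N. real (Suc N choose k) * parking_number k k *
            parking_number (Suc N - k) (n - Suc k) * (real k * (real k + 1) / 2))
     = (\<Sum>k\<le>Suc N. real k * real (Suc N choose k) *
          ((1 + real k) ^ k / 2 * abel_kernel y (Suc N - k)))"
    using assms by (intro sum.cong) (auto simp: split add_ac)
  also have "\<dots> = real (Suc N) / 2 *
      (\<Sum>j\<le>N. real (N choose j) * (2 + real j) ^ Suc j * abel_kernel y (N - j))"
    unfolding sum_binomial_absorb sum_distrib_left
    by (intro sum.cong) (auto simp: add_ac)
  also have "(\<Sum>j\<le>N. real (N choose j) * (2 + real j) ^ Suc j * abel_kernel y (N - j))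
      = (real n + 1) ^ N *
            (\<Sum>i\<le>N. (\<Prod>t<i. (real N - real t) / (real n + 1)) * (2 + real i))"
    by (rule abel_binomial_succ_power[OF y]) (auto simp: y_def)
  finally show ?thesis .
qed

section \<open>Weights of sets of occupied spots\<close>

text \<open>
  The number of preferences, weighted by the coin, that lead the next car to the free spot \<open>s\<close> when \<open>S\<close>
  is occupied: \<open>s\<close> itself, the run of occupied spots that ends just below \<open>s\<close> (the car moves
  forward), and the run that starts just above \<open>s\<close> (the car moves backward). The formula is local:
  it refers only to the spots between \<open>s\<close> and the nearest free spots on either side.
\<close>

definition park_mass :: "real \<Rightarrow> nat set \<Rightarrow> nat \<Rightarrow> real" where
  "park_mass p S s = 1 + p * real (card {a. a < s \<and> {a..<s} \<subseteq> S})
                       + (1 - p) * real (card {a. s < a \<and> {s<..a} \<subseteq> S})"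

text \<open>
  For \<open>card T = k\<close>, the sum over all preference lists of \<open>k\<close> cars of the probability that all
  of them park and occupy exactly \<open>T\<close>; the recursion removes the spot of the last car.
  The number of cars is a separate argument because it drives the recursion.
\<close>

fun occupation_weight :: "real \<Rightarrow> nat \<Rightarrow> nat set \<Rightarrow> real" where
  "occupation_weight p 0 T = 1"
| "occupation_weight p (Suc k) T =
     (\<Sum>s\<in>T. park_mass p (T - {s}) s * occupation_weight p k (T - {s}))"

definition subsets_of_card :: "nat set \<Rightarrow> nat \<Rightarrow> nat set set" where
  "subsets_of_card I m = {T. T \<subseteq> I \<and> card T = m}"

definition total_weight :: "real \<Rightarrow> nat \<Rightarrow> nat set \<Rightarrow> real" where
  "total_weight p m I = (\<Sum>T\<in>subsets_of_card I m. occupation_weight p m T)"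

lemma finite_subsets_of_card [simp]: "finite I \<Longrightarrow> finite (subsets_of_card I m)"
  unfolding subsets_of_card_def by simp

text \<open>
  Both sides sum over pairs of a set of \<open>m + 1\<close> spots and the spot in it that the last car took.
\<close>

lemma sum_add_car:
  fixes g :: "nat set \<Rightarrow> real"
  assumes I: "finite I"
  shows "(\<Sum>T\<in>subsets_of_card I m. occupation_weight p m T *
            (\<Sum>s\<in>I - T. park_mass p T s * g (insert s T)))
       = (\<Sum>T\<in>subsets_of_card I (Suc m). occupation_weight p (Suc m) T * g T)"
proof -
  have fin: "finite T" if "T \<in> subsets_of_card I k" for T k
    using that I finite_subset by (auto simp: subsets_of_card_def)
  have "(\<Sum>T\<in>subsets_of_card I m. occupation_weight p m T *
            (\<Sum>s\<in>I - T. park_mass p T s * g (insert s T)))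
      = (\<Sum>(T,s)\<in>Sigma (subsets_of_card I m) (\<lambda>T. I - T).
            occupation_weight p m T * (park_mass p T s * g (insert s T)))"
    unfolding sum_distrib_left by (rule sum.Sigma) (use I in auto)
  also have "\<dots> = (\<Sum>(T,s)\<in>Sigma (subsets_of_card I (Suc m)) (\<lambda>T. T).
            park_mass p (T - {s}) s * occupation_weight p m (T - {s}) * g T)"
    by (rule sum.reindex_bij_witness[where i = "\<lambda>(T,s). (T - {s}, s)" and j = "\<lambda>(T,s). (insert s T, s)"])
       (auto simp: subsets_of_card_def insert_absorb card_insert_if finite_subset[OF _ I])
  also have "\<dots> = (\<Sum>T\<in>subsets_of_card I (Suc m). \<Sum>s\<in>T.
            park_mass p (T - {s}) s * occupation_weight p m (T - {s}) * g T)"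
    by (rule sum.Sigma[symmetric]) (use I fin in auto)
  also have "\<dots> = (\<Sum>T\<in>subsets_of_card I (Suc m). occupation_weight p (Suc m) T * g T)"
    by (simp add: sum_distrib_right)
  finally show ?thesis .
qed

text \<open>
  A run of occupied spots cannot cross the free spot \<open>q\<close>, so the two sides do not see each other.
\<close>

lemma park_mass_separated:
  assumes below: "\<forall>x\<in>A. x < q" and above: "\<forall>x\<in>B. q < x"
  shows "s < q \<Longrightarrow> park_mass p (A \<union> B) s = park_mass p A s"
    and "q < s \<Longrightarrow> park_mass p (A \<union> B) s = park_mass p B s"
proof -
  have q: "q \<notin> A" "q \<notin> B" using assms by auto
  show "park_mass p (A \<union> B) s = park_mass p A s" if s: "s < q"
  proof -
    have "{a..<s} \<subseteq> A \<union> B \<longleftrightarrow> {a..<s} \<subseteq> A" for a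
      using s above by force
    moreover have "{s<..a} \<subseteq> A \<union> B \<longleftrightarrow> {s<..a} \<subseteq> A" if "s < a" for a
    proof (cases "a < q")
      case True thus ?thesis using above by force
    next
      case False
      hence "q \<in> {s<..a}" using s by auto
      thus ?thesis using q by blast
    qed
    ultimately show ?thesis unfolding park_mass_def by (auto cong: conj_cong)
  qed
  show "park_mass p (A \<union> B) s = park_mass p B s" if s: "q < s"
  proof -
    have "{s<..a} \<subseteq> A \<union> B \<longleftrightarrow> {s<..a} \<subseteq> B" for a
      using s below by force
    moreover have "{a..<s} \<subseteq> A \<union> B \<longleftrightarrow> {a..<s} \<subseteq> B" if "a < s" for a
    proof (cases "q < a")
      case True thus ?thesis using below by force
    next
      case False
      hence "q \<in> {a..<s}" using s by auto
      thus ?thesis using q by blast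
    qed
    ultimately show ?thesis unfolding park_mass_def by (auto cong: conj_cong)
  qed
qed

text \<open>
  Cars on different sides of a spot that stays free never interact, so the weights multiply, and
  the binomial coefficient chooses which of the cars go to the lower side. In the induction the
  last car belongs to one of the sides, which is Pascal's rule.
\<close>

lemma occupation_weight_separated:
  assumes "finite A" "finite B" "card A = i" "card B = j"
      and "\<forall>x\<in>A. x < q" "\<forall>x\<in>B. q < x"
  shows "occupation_weight p (i + j) (A \<union> B)
       = real ((i + j) choose i) * occupation_weight p i A * occupation_weight p j B"
  using assms
proof (induction "i + j" arbitrary: i j A B)
  case 0
  thus ?case by simp
next
  case (Suc N)
  show ?case
  proof (cases "i = 0 \<or> j = 0")
    case True
    thus ?thesis using Suc.prems by auto
  next
    case False
    then obtain i' j' where ij: "i = Suc i'" "j = Suc j'" by (metis not0_implies_Suc)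
    have N: "N = i' + j" "N = i + j'" using Suc.hyps(2) ij by auto
    have disj: "A \<inter> B = {}" using Suc.prems(5,6) by fastforce
    have A: "occupation_weight p N (A \<union> B - {s})
        = real (N choose i') * occupation_weight p i' (A - {s}) * occupation_weight p j B"
      if s: "s \<in> A" for s
    proof -
      have "A \<union> B - {s} = (A - {s}) \<union> B" using disj s by auto
      moreover have "card (A - {s}) = i'" using s Suc.prems ij by simp
      ultimately show ?thesis
        using Suc.hyps(1)[OF N(1), of "A - {s}" B] Suc.prems N(1) by simp
    qed
    have B: "occupation_weight p N (A \<union> B - {s})
        = real (N choose i) * occupation_weight p i A * occupation_weight p j' (B - {s})"
      if s: "s \<in> B" for s
    proof -
      have "A \<union> B - {s} = A \<union> (B - {s})" using disj s by auto
      moreover have "card (B - {s}) = j'" using s Suc.prems ij by simp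
      ultimately show ?thesis
        using Suc.hyps(1)[OF N(2), of A "B - {s}"] Suc.prems N(2) by simp
    qed
    have mA: "park_mass p (A \<union> B - {s}) s = park_mass p (A - {s}) s" if s: "s \<in> A" for s
    proof -
      have "A \<union> B - {s} = (A - {s}) \<union> B" using disj s by auto
      thus ?thesis using park_mass_separated(1)[of "A - {s}" q B s p] Suc.prems s by simp
    qed
    have mB: "park_mass p (A \<union> B - {s}) s = park_mass p (B - {s}) s" if s: "s \<in> B" for s
    proof -
      have "A \<union> B - {s} = A \<union> (B - {s})" using disj s by auto
      thus ?thesis using park_mass_separated(2)[of A q "B - {s}" s p] Suc.prems s by simp
    qed
    have "occupation_weight p (Suc N) (A \<union> B)
        = (\<Sum>s\<in>A. park_mass p (A - {s}) s *
              (real (N choose i') * occupation_weight p i' (A - {s}) * occupation_weight p j B))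
        + (\<Sum>s\<in>B. park_mass p (B - {s}) s *
              (real (N choose i) * occupation_weight p i A * occupation_weight p j' (B - {s})))"
      by (simp add: sum.union_disjoint Suc.prems disj A B mA mB)
    also have "\<dots> = real (N choose i') * occupation_weight p i A * occupation_weight p j B
        + real (N choose i) * occupation_weight p i A * occupation_weight p j B"
    proof -
      have "(\<Sum>s\<in>A. park_mass p (A - {s}) s *
              (real (N choose i') * occupation_weight p i' (A - {s}) * occupation_weight p j B))
          = real (N choose i') * occupation_weight p i A * occupation_weight p j B"
        by (simp only: ij(1) occupation_weight.simps(2) sum_distrib_left sum_distrib_right mult_ac)
      moreover have "(\<Sum>s\<in>B. park_mass p (B - {s}) s *
              (real (N choose i) * occupation_weight p i A * occupation_weight p j' (B - {s})))
          = real (N choose i) * occupation_weight p i A * occupation_weight p j B"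
        by (simp only: ij(2) occupation_weight.simps(2) sum_distrib_left sum_distrib_right mult_ac)
      ultimately show ?thesis by simp
    qed
    also have "\<dots> = real (Suc N choose i) * occupation_weight p i A * occupation_weight p j B"
      unfolding ij by (simp add: algebra_simps)
    finally show ?thesis using Suc.hyps(2) by simp
  qed
qed

text \<open>
  If \<open>q\<close> enumerates an interval upwards or downwards, this is the length of the run of occupied
  spots at the end where the enumeration starts. Treating both directions through \<open>q\<close> covers
  forward and backward failures with one argument.
\<close>

definition end_run :: "(nat \<Rightarrow> nat) \<Rightarrow> nat set \<Rightarrow> nat" where
  "end_run q T = (LEAST k. q k \<notin> T)"

lemma end_run:
  assumes "inj_on q {..<n}" "T \<in> subsets_of_card (q ` {..<n}) m" "m < n"
  shows "q (end_run q T) \<notin> T" "q ` {..<end_run q T} \<subseteq> T" "end_run q T \<le> m"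
proof -
  have T: "T \<subseteq> q ` {..<n}" "card T = m" using assms(2) by (auto simp: subsets_of_card_def)
  have fin: "finite T" using T(1) finite_subset by blast
  have "\<exists>k\<le>m. q k \<notin> T"
  proof (rule ccontr)
    assume "\<not> (\<exists>k\<le>m. q k \<notin> T)"
    hence "q ` {..m} \<subseteq> T" by auto
    moreover have "card (q ` {..m}) = Suc m"
      using assms(1,3) by (subst card_image, intro inj_on_subset[OF assms(1)]) auto
    ultimately show False using card_mono[OF fin, of "q ` {..m}"] T(2) by simp
  qed
  then obtain k where k: "k \<le> m" "q k \<notin> T" by blast
  show "q (end_run q T) \<notin> T" unfolding end_run_def using k(2) by (rule LeastI)
  show "q ` {..<end_run q T} \<subseteq> T" unfolding end_run_def using not_less_Least by blast
  show "end_run q T \<le> m" using Least_le[of "\<lambda>k. q k \<notin> T" k] k unfolding end_run_def by simp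
qed

lemma end_run_eq:
  assumes "inj_on q {..<n}" "k < n" "U \<subseteq> q ` {k<..<n}"
  shows "end_run q (q ` {..<k} \<union> U) = k"
  unfolding end_run_def
proof (rule Least_equality)
  have "q k \<notin> q ` ({..<n} - {k})"
    using inj_on_image_mem_iff[OF assms(1), of k "{..<n} - {k}"] assms(2) by auto
  moreover have "q ` {..<k} \<union> U \<subseteq> q ` ({..<n} - {k})"
    using assms(2,3) by fastforce
  ultimately show "q k \<notin> q ` {..<k} \<union> U" by blast
  show "k \<le> j" if "q j \<notin> q ` {..<k} \<union> U" for j
    using that by (meson UnCI imageI lessThan_iff not_le)
qed

lemma strict_monotone_imp_inj_on:
  fixes q :: "nat \<Rightarrow> nat"
  assumes "strict_mono_on S q \<or> strict_antimono_on S q"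
  shows "inj_on q S"
  using assms
proof
  assume "strict_antimono_on S q"
  thus ?thesis by (intro linorder_inj_onI') (fastforce simp: monotone_on_def)
qed (rule strict_mono_on_imp_inj_on)

lemma occupation_weight_end_run:
  assumes mono: "strict_mono_on {..<n} q \<or> strict_antimono_on {..<n} q"
      and k: "k < n" "k \<le> m" and U: "U \<in> subsets_of_card (q ` {k<..<n}) (m - k)"
  shows "occupation_weight p m (q ` {..<k} \<union> U)
       = real (m choose k) * occupation_weight p k (q ` {..<k}) * occupation_weight p (m - k) U"
proof -
  have inj: "inj_on q {..<n}"
    using mono by (rule strict_monotone_imp_inj_on)
  have U': "U \<subseteq> q ` {k<..<n}" "finite U" "card U = m - k"
    using U finite_subset by (auto simp: subsets_of_card_def)
  have B: "card (q ` {..<k}) = k"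
    using k by (subst card_image, intro inj_on_subset[OF inj]) auto
  from mono show ?thesis
  proof
    assume m: "strict_mono_on {..<n} q"
    have "occupation_weight p (k + (m - k)) (q ` {..<k} \<union> U)
       = real ((k + (m - k)) choose k) * occupation_weight p k (q ` {..<k}) * occupation_weight p (m - k) U"
      by (rule occupation_weight_separated[where q = "q k"])
         (use U' B k in \<open>auto intro!: strict_mono_onD[OF m]\<close>)
    thus ?thesis using k by simp
  next
    assume m: "strict_antimono_on {..<n} q"
    have "occupation_weight p ((m - k) + k) (U \<union> q ` {..<k})
       = real (((m - k) + k) choose (m - k)) * occupation_weight p (m - k) U * occupation_weight p k (q ` {..<k})"
      by (rule occupation_weight_separated[where q = "q k"])
         (use U' B k in \<open>auto intro!: monotone_onD[OF m]\<close>)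
    thus ?thesis using k by (simp add: Un_commute binomial_symmetric[of k m])
  qed
qed

lemma total_weight_full:
  assumes "finite I" "card I = k"
  shows "total_weight p k I = occupation_weight p k I"
proof -
  have "subsets_of_card I k = {I}"
    using assms(2) by (auto simp: subsets_of_card_def dest: card_subset_eq[OF assms(1)])
  thus ?thesis by (simp add: total_weight_def)
qed

text \<open>
  With fewer cars than spots, the end run is followed by a free spot. The outcomes with end run
  of length \<open>k\<close> therefore split into a completely filled street of length \<open>k\<close> and an arbitrary
  outcome of the other \<open>m - k\<close> cars beyond that free spot.
\<close>

lemma sum_by_end_run:
  fixes g :: "nat \<Rightarrow> real"
  assumes mono: "strict_mono_on {..<n} q \<or> strict_antimono_on {..<n} q" and m: "m < n"
  shows "(\<Sum>T\<in>subsets_of_card (q ` {..<n}) m. occupation_weight p m T * g (end_run q T))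
       = (\<Sum>k\<le>m. real (m choose k) * total_weight p k (q ` {..<k}) *
            total_weight p (m - k) (q ` {k<..<n}) * g k)"
proof -
  have inj: "inj_on q {..<n}"
    using mono by (rule strict_monotone_imp_inj_on)
  have cardB: "card (q ` {..<k}) = k" if "k \<le> m" for k
    using m that by (subst card_image, intro inj_on_subset[OF inj]) auto
  have disj: "q ` {..<k} \<inter> U = {}" if "U \<subseteq> q ` {k<..<n}" "k \<le> m" for k U
    using that inj m by (fastforce simp: inj_on_def)
  have "(\<Sum>T\<in>subsets_of_card (q ` {..<n}) m. occupation_weight p m T * g (end_run q T))
     = (\<Sum>(k,U)\<in>Sigma {..m} (\<lambda>k. subsets_of_card (q ` {k<..<n}) (m - k)).
          occupation_weight p m (q ` {..<k} \<union> U) * g k)"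
  proof (rule sum.reindex_bij_witness[where i = "\<lambda>(k,U). q ` {..<k} \<union> U"
        and j = "\<lambda>T. (end_run q T, T - q ` {..<end_run q T})"], goal_cases)
    case (1 T)
    thus ?case using end_run(2)[OF inj _ m] by auto
  next
    case (2 T)
    let ?k = "end_run q T"
    note r = end_run[OF inj 2 m]
    have T: "T \<subseteq> q ` {..<n}" "card T = m" using 2 by (auto simp: subsets_of_card_def)
    have "T - q ` {..<?k} \<subseteq> q ` {?k<..<n}"
    proof
      fix x assume x: "x \<in> T - q ` {..<?k}"
      then obtain i where i: "x = q i" "i < n" using T(1) by auto
      have "i \<noteq> ?k" using r(1) x i by auto
      moreover have "\<not> i < ?k" using x i by auto
      ultimately show "x \<in> q ` {?k<..<n}" using i by auto
    qed
    moreover have "card (T - q ` {..<?k}) = m - ?k"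
      using r T cardB by (simp add: card_Diff_subset)
    ultimately show ?case using r(3) by (auto simp: subsets_of_card_def)
  next
    case (3 b)
    then obtain k U where b: "b = (k, U)" "k \<le> m" "U \<subseteq> q ` {k<..<n}"
      by (auto simp: subsets_of_card_def)
    have "end_run q (q ` {..<k} \<union> U) = k"
      using end_run_eq[OF inj _ b(3)] b m by auto
    thus ?case using disj[OF b(3,2)] b(1) by auto
  next
    case (4 b)
    then obtain k U where b: "b = (k, U)" "k \<le> m" "U \<subseteq> q ` {k<..<n}" "card U = m - k"
      by (auto simp: subsets_of_card_def)
    have "finite U" using b(3) finite_subset by blast
    hence "card (q ` {..<k} \<union> U) = m"
      using disj[OF b(3,2)] b cardB by (subst card_Un_disjoint) auto
    moreover have "q ` {..<k} \<union> U \<subseteq> q ` {..<n}" using b m by auto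
    ultimately show ?case using b by (auto simp: subsets_of_card_def)
  next
    case (5 T)
    thus ?case using end_run(2)[OF inj 5 m] by (simp add: Un_absorb1)
  qed
  also have "\<dots> = (\<Sum>k\<le>m. \<Sum>U\<in>subsets_of_card (q ` {k<..<n}) (m - k).
          occupation_weight p m (q ` {..<k} \<union> U) * g k)"
    by (rule sum.Sigma[symmetric]) auto
  also have "\<dots> = (\<Sum>k\<le>m. real (m choose k) * total_weight p k (q ` {..<k}) *
            total_weight p (m - k) (q ` {k<..<n}) * g k)"
  proof (rule sum.cong[OF refl])
    fix k assume "k \<in> {..m}"
    hence k: "k < n" "k \<le> m" using m by auto
    have "total_weight p k (q ` {..<k}) = occupation_weight p k (q ` {..<k})"
      by (rule total_weight_full) (use cardB k in auto)
    thus "(\<Sum>U\<in>subsets_of_card (q ` {k<..<n}) (m - k). occupation_weight p m (q ` {..<k} \<union> U) * g k)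
       = real (m choose k) * total_weight p k (q ` {..<k}) *
            total_weight p (m - k) (q ` {k<..<n}) * g k"
      by (simp add: occupation_weight_end_run[OF mono k] total_weight_def[of p "m - k"]
          sum_distrib_left sum_distrib_right)
  qed
  finally show ?thesis .
qed

section \<open>Total weights and end runs\<close>

text \<open>
  Streets are written \<open>{l<..l + n}\<close>, because the part of a street beyond an end run is again of this
  form. These are the two enumerations of such a street to which \<open>end_run\<close> is applied.
\<close>

lemma upward_image: "(\<lambda>i. l + Suc i) ` {..<j} = {l<..l + j}"
proof -
  have "x \<in> (\<lambda>i. l + Suc i) ` {..<j}" if "x \<in> {l<..l + j}" for x
    using that by (intro image_eqI[where x = "x - Suc l"]) auto
  thus ?thesis by auto
qed

lemma downward_image:
  fixes l n :: nat
  assumes "j \<le> n"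
  shows "(\<lambda>i. l + n - i) ` {..<j} = {l + n - j<..l + n}"
proof -
  have "x \<in> (\<lambda>i. l + n - i) ` {..<j}" if "x \<in> {l + n - j<..l + n}" for x
    using that assms by (intro image_eqI[where x = "l + n - x"]) auto
  thus ?thesis using assms by auto
qed

lemma leading_run:
  assumes T: "T \<in> subsets_of_card {l<..l + n} m" and m: "m < n"
  defines "k \<equiv> end_run (\<lambda>i. l + Suc i) T"
  shows "{a \<in> {l<..l + n}. {l<..a} \<subseteq> T} = {l<..l + k}" (is "?L = _")
proof -
  have inj: "inj_on (\<lambda>i. l + Suc i) {..<n}" by (auto intro: inj_onI)
  note r = end_run[OF inj _ m, unfolded upward_image, OF T, folded k_def]
  show ?thesis
  proof
    show "?L \<subseteq> {l<..l + k}"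
    proof
      fix a assume a: "a \<in> ?L"
      have "l + Suc k \<notin> {l<..a}" using a r(1) by blast
      thus "a \<in> {l<..l + k}" using a by simp
    qed
    show "{l<..l + k} \<subseteq> ?L"
    proof
      fix a assume a: "a \<in> {l<..l + k}"
      hence "{l<..a} \<subseteq> {l<..l + k}" by auto
      thus "a \<in> ?L" using r(2,3) m a by auto
    qed
  qed
qed

lemma trailing_run:
  assumes T: "T \<in> subsets_of_card {l<..l + n} m" and m: "m < n"
  defines "k \<equiv> end_run (\<lambda>i. l + n - i) T"
  shows "{a \<in> {l<..l + n}. {a..l + n} \<subseteq> T} = {l + n - k<..l + n}" and "k \<le> m"
proof -
  have inj: "inj_on (\<lambda>i. l + n - i) {..<n}" by (auto intro!: inj_onI)
  have T': "T \<in> subsets_of_card ((\<lambda>i. l + n - i) ` {..<n}) m" using T by (simp add: downward_image)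
  note r = end_run[OF inj T' m, folded k_def]
  show km: "k \<le> m" by (rule r(3))
  show "{a \<in> {l<..l + n}. {a..l + n} \<subseteq> T} = {l + n - k<..l + n}" (is "?R = _")
  proof
    show "?R \<subseteq> {l + n - k<..l + n}"
    proof
      fix a assume a: "a \<in> ?R"
      have "l + n - k \<notin> {a..l + n}" using a r(1) by blast
      thus "a \<in> {l + n - k<..l + n}" using a by simp
    qed
    show "{l + n - k<..l + n} \<subseteq> ?R"
    proof
      fix a assume a: "a \<in> {l + n - k<..l + n}"
      hence "{a..l + n} \<subseteq> {l + n - k<..l + n}" by auto
      also have "\<dots> \<subseteq> T" using r(2) downward_image[of k n l] km m by simp
      finally show "a \<in> ?R" using km m a by auto
    qed
  qed
qed

text \<open>
  Every occupied spot \<open>a\<close> sends a forward-moving car to exactly one free spot, unless all spots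
  from \<open>a\<close> to the end are occupied. The runs below the free spots are thus a partition
  of \<open>T\<close> without its trailing run.
\<close>

lemma sum_card_forward:
  fixes u :: nat
  assumes T: "T \<subseteq> {l<..u}"
  shows "(\<Sum>s\<in>{l<..u} - T. card {a. a < s \<and> {a..<s} \<subseteq> T})
       = card T - card {a \<in> {l<..u}. {a..u} \<subseteq> T}"
proof -
  have finT: "finite T" using finite_subset[OF T] by simp
  have run: "{a \<in> {l<..u}. {a..u} \<subseteq> T} \<subseteq> T"
  proof
    fix a assume a: "a \<in> {a \<in> {l<..u}. {a..u} \<subseteq> T}"
    hence "a \<in> {a..u}" by simp
    thus "a \<in> T" using a by blast
  qed
  have fin: "finite {a. a < s \<and> {a..<s} \<subseteq> T}" for s :: nat
    by (rule finite_subset[of _ "{..<s}"]) auto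
  have "(\<Sum>s\<in>{l<..u} - T. card {a. a < s \<and> {a..<s} \<subseteq> T})
      = card (\<Union>s\<in>{l<..u} - T. {a. a < s \<and> {a..<s} \<subseteq> T})"
  proof (rule card_UN_disjoint[symmetric])
    show "\<forall>s\<in>{l<..u} - T. \<forall>s'\<in>{l<..u} - T. s \<noteq> s' \<longrightarrow>
        {a. a < s \<and> {a..<s} \<subseteq> T} \<inter> {a. a < s' \<and> {a..<s'} \<subseteq> T} = {}"
    proof (intro ballI impI equals0I)
      fix s s' a assume s: "s \<in> {l<..u} - T" "s' \<in> {l<..u} - T" "s \<noteq> s'"
        and a: "a \<in> {a. a < s \<and> {a..<s} \<subseteq> T} \<inter> {a. a < s' \<and> {a..<s'} \<subseteq> T}"
      have "s \<in> {a..<s'} \<or> s' \<in> {a..<s}" using s(3) a by auto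
      thus False using s a by blast
    qed
  qed (use fin in auto)
  also have "(\<Union>s\<in>{l<..u} - T. {a. a < s \<and> {a..<s} \<subseteq> T}) = T - {a \<in> {l<..u}. {a..u} \<subseteq> T}"
  proof (intro equalityI subsetI)
    fix a assume "a \<in> (\<Union>s\<in>{l<..u} - T. {a. a < s \<and> {a..<s} \<subseteq> T})"
    then obtain s where s: "s \<in> {l<..u}" "s \<notin> T" "a < s" "{a..<s} \<subseteq> T" by blast
    have "a \<in> T" using s by auto
    moreover have "s \<in> {a..u}" using s by auto
    ultimately show "a \<in> T - {a \<in> {l<..u}. {a..u} \<subseteq> T}" using s by blast
  next
    fix a assume a: "a \<in> T - {a \<in> {l<..u}. {a..u} \<subseteq> T}"
    hence "\<exists>x. a \<le> x \<and> x \<le> u \<and> x \<notin> T" using T by auto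
    then obtain x where x: "a \<le> x" "x \<le> u" "x \<notin> T" by blast
    define s where "s = (LEAST x. a \<le> x \<and> x \<notin> T)"
    have s: "a \<le> s" "s \<notin> T" unfolding s_def using LeastI[of "\<lambda>x. a \<le> x \<and> x \<notin> T" x] x by auto
    have "s \<le> x" unfolding s_def using x by (intro Least_le) auto
    moreover have "a < s" using s a by (cases "a = s") auto
    moreover have "{a..<s} \<subseteq> T" unfolding s_def using not_less_Least by fastforce
    moreover have "l < a" using a T by auto
    ultimately show "a \<in> (\<Union>s\<in>{l<..u} - T. {a. a < s \<and> {a..<s} \<subseteq> T})"
      using s x by (intro UN_I[of s]) auto
  qed
  also have "card (T - {a \<in> {l<..u}. {a..u} \<subseteq> T}) = card T - card {a \<in> {l<..u}. {a..u} \<subseteq> T}"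
    using run by (intro card_Diff_subset finite_subset[OF run finT])
  finally show ?thesis .
qed

text \<open>
  The mirror image: a backward-moving car is lost only from the leading run.
\<close>

lemma sum_card_backward:
  fixes u :: nat
  assumes T: "T \<subseteq> {l<..u}"
  shows "(\<Sum>s\<in>{l<..u} - T. card {a. s < a \<and> {s<..a} \<subseteq> T})
       = card T - card {a \<in> {l<..u}. {l<..a} \<subseteq> T}"
proof -
  have finT: "finite T" using finite_subset[OF T] by simp
  have run: "{a \<in> {l<..u}. {l<..a} \<subseteq> T} \<subseteq> T"
  proof
    fix a assume a: "a \<in> {a \<in> {l<..u}. {l<..a} \<subseteq> T}"
    hence "a \<in> {l<..a}" by simp
    thus "a \<in> T" using a by blast
  qed
  have fin: "finite {a. s < a \<and> {s<..a} \<subseteq> T}" for s :: nat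
    by (rule finite_subset[OF _ finT]) auto
  have "(\<Sum>s\<in>{l<..u} - T. card {a. s < a \<and> {s<..a} \<subseteq> T})
      = card (\<Union>s\<in>{l<..u} - T. {a. s < a \<and> {s<..a} \<subseteq> T})"
  proof (rule card_UN_disjoint[symmetric])
    show "\<forall>s\<in>{l<..u} - T. \<forall>s'\<in>{l<..u} - T. s \<noteq> s' \<longrightarrow>
        {a. s < a \<and> {s<..a} \<subseteq> T} \<inter> {a. s' < a \<and> {s'<..a} \<subseteq> T} = {}"
    proof (intro ballI impI equals0I)
      fix s s' a assume s: "s \<in> {l<..u} - T" "s' \<in> {l<..u} - T" "s \<noteq> s'"
        and a: "a \<in> {a. s < a \<and> {s<..a} \<subseteq> T} \<inter> {a. s' < a \<and> {s'<..a} \<subseteq> T}"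
      have "s \<in> {s'<..a} \<or> s' \<in> {s<..a}" using s(3) a by auto
      thus False using s a by blast
    qed
  qed (use fin in auto)
  also have "(\<Union>s\<in>{l<..u} - T. {a. s < a \<and> {s<..a} \<subseteq> T}) = T - {a \<in> {l<..u}. {l<..a} \<subseteq> T}"
  proof (intro equalityI subsetI)
    fix a assume "a \<in> (\<Union>s\<in>{l<..u} - T. {a. s < a \<and> {s<..a} \<subseteq> T})"
    then obtain s where s: "s \<in> {l<..u}" "s \<notin> T" "s < a" "{s<..a} \<subseteq> T" by blast
    have "a \<in> T" using s by auto
    moreover have "s \<in> {l<..a}" using s by auto
    ultimately show "a \<in> T - {a \<in> {l<..u}. {l<..a} \<subseteq> T}" using s by blast
  next
    fix a assume a: "a \<in> T - {a \<in> {l<..u}. {l<..a} \<subseteq> T}"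
    define X where "X = {l<..a} - T"
    have X: "finite X" "X \<noteq> {}" using a T by (auto simp: X_def)
    define s where "s = Max X"
    have s: "s \<in> X" unfolding s_def by (rule Max_in[OF X])
    have "{s<..a} \<subseteq> T"
    proof
      fix x assume x: "x \<in> {s<..a}"
      show "x \<in> T"
      proof (rule ccontr)
        assume "x \<notin> T"
        hence "x \<in> X" using x s by (auto simp: X_def)
        hence "x \<le> s" unfolding s_def by (rule Max_ge[OF X(1)])
        thus False using x by simp
      qed
    qed
    moreover have "s < a" using s a unfolding X_def by (cases "a = s") auto
    moreover have "a \<le> u" using a T by auto
    ultimately show "a \<in> (\<Union>s\<in>{l<..u} - T. {a. s < a \<and> {s<..a} \<subseteq> T})"
      using s unfolding X_def by (intro UN_I[of s]) auto
  qed
  also have "card (T - {a \<in> {l<..u}. {l<..a} \<subseteq> T}) = card T - card {a \<in> {l<..u}. {l<..a} \<subseteq> T}"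
    using run by (intro card_Diff_subset finite_subset[OF run finT])
  finally show ?thesis .
qed

text \<open>
  Of the \<open>n\<close> preferences of the next car, those in the trailing run fail with probability \<open>p\<close>, and
  those in the leading run with probability \<open>1 - p\<close>.
\<close>

lemma sum_park_mass_free:
  assumes T: "T \<subseteq> {l<..l + n}"
  shows "(\<Sum>s\<in>{l<..l + n} - T. park_mass p T s)
       = real n - p * real (card {a \<in> {l<..l + n}. {a..l + n} \<subseteq> T})
                - (1 - p) * real (card {a \<in> {l<..l + n}. {l<..a} \<subseteq> T})"
proof -
  let ?I = "{l<..l + n}"
  let ?R = "{a \<in> ?I. {a..l + n} \<subseteq> T}" and ?L = "{a \<in> ?I. {l<..a} \<subseteq> T}"
  have finT: "finite T" using finite_subset[OF T] by simp
  have R: "card ?R \<le> card T"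
  proof (rule card_mono[OF finT], rule subsetI)
    fix a assume a: "a \<in> ?R"
    hence "a \<in> {a..l + n}" by simp
    thus "a \<in> T" using a by blast
  qed
  have L: "card ?L \<le> card T"
  proof (rule card_mono[OF finT], rule subsetI)
    fix a assume a: "a \<in> ?L"
    hence "a \<in> {l<..a}" by simp
    thus "a \<in> T" using a by blast
  qed
  have "card T \<le> n" using card_mono[OF _ T] by simp
  have free: "card (?I - T) = n - card T"
    using T finT by (simp add: card_Diff_subset)
  have "(\<Sum>s\<in>?I - T. park_mass p T s)
      = real (card (?I - T)) + p * real (\<Sum>s\<in>?I - T. card {a. a < s \<and> {a..<s} \<subseteq> T})
        + (1 - p) * real (\<Sum>s\<in>?I - T. card {a. s < a \<and> {s<..a} \<subseteq> T})"
    by (simp add: park_mass_def sum.distrib sum_distrib_left)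
  also have "\<dots> = (real n - real (card T)) + p * (real (card T) - real (card ?R))
        + (1 - p) * (real (card T) - real (card ?L))"
    unfolding sum_card_forward[OF T] sum_card_backward[OF T] free
    using R L \<open>card T \<le> n\<close> by (simp add: of_nat_diff)
  finally show ?thesis by (simp add: algebra_simps)
qed

text \<open>
  The value of the total weights is a premise here so that the lemma can be applied to smaller
  numbers of cars within the induction that proves this value.
\<close>

lemma sum_by_leading_run:
  fixes g :: "nat \<Rightarrow> real"
  assumes m: "m < n"
    and weight: "\<And>k l n. k \<le> m \<Longrightarrow> k \<le> n \<Longrightarrow> total_weight p k {l<..l + n} = parking_number k n"
  shows "(\<Sum>T\<in>subsets_of_card {l<..l + n} m. occupation_weight p m T *
            g (card {a \<in> {l<..l + n}. {l<..a} \<subseteq> T}))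
       = (\<Sum>k\<le>m. real (m choose k) * parking_number k k * parking_number (m - k) (n - Suc k) * g k)"
proof -
  let ?q = "\<lambda>i. l + Suc i"
  have q2: "?q ` {k<..<n} = {(l + Suc k)<..(l + Suc k) + (n - Suc k)}" if "k < n" for k
  proof -
    have "x \<in> ?q ` {k<..<n}" if "x \<in> {(l + Suc k)<..(l + Suc k) + (n - Suc k)}" for x
      using that by (intro image_eqI[where x = "x - Suc l"]) auto
    thus ?thesis using that by auto
  qed
  have mono: "strict_mono_on {..<n} ?q \<or> strict_antimono_on {..<n} ?q"
    by (auto simp: strict_mono_on_def)
  have "(\<Sum>T\<in>subsets_of_card {l<..l + n} m. occupation_weight p m T *
            g (card {a \<in> {l<..l + n}. {l<..a} \<subseteq> T}))
      = (\<Sum>T\<in>subsets_of_card (?q ` {..<n}) m. occupation_weight p m T * g (end_run ?q T))"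
    unfolding upward_image by (intro sum.cong refl) (simp only: leading_run[OF _ m], simp)
  also have "\<dots> = (\<Sum>k\<le>m. real (m choose k) * total_weight p k (?q ` {..<k}) *
            total_weight p (m - k) (?q ` {k<..<n}) * g k)"
    by (rule sum_by_end_run[OF mono m])
  also have "\<dots> = (\<Sum>k\<le>m. real (m choose k) * parking_number k k *
            parking_number (m - k) (n - Suc k) * g k)"
  proof (rule sum.cong[OF refl])
    fix k assume "k \<in> {..m}"
    hence k: "k \<le> m" "k < n" using m by auto
    show "real (m choose k) * total_weight p k (?q ` {..<k}) *
            total_weight p (m - k) (?q ` {k<..<n}) * g k
        = real (m choose k) * parking_number k k * parking_number (m - k) (n - Suc k) * g k"
      unfolding upward_image q2[OF k(2)] using k m weight[of k k l] weight[of "m - k" "n - Suc k" "l + Suc k"]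
      by simp
  qed
  finally show ?thesis .
qed

lemma sum_by_trailing_run:
  fixes g :: "nat \<Rightarrow> real"
  assumes m: "m < n"
    and weight: "\<And>k l n. k \<le> m \<Longrightarrow> k \<le> n \<Longrightarrow> total_weight p k {l<..l + n} = parking_number k n"
  shows "(\<Sum>T\<in>subsets_of_card {l<..l + n} m. occupation_weight p m T *
            g (card {a \<in> {l<..l + n}. {a..l + n} \<subseteq> T}))
       = (\<Sum>k\<le>m. real (m choose k) * parking_number k k * parking_number (m - k) (n - Suc k) * g k)"
proof -
  let ?q = "\<lambda>i. l + n - i"
  have q2: "?q ` {k<..<n} = {l<..l + (n - Suc k)}" if "k < n" for k
  proof -
    have "x \<in> ?q ` {k<..<n}" if "x \<in> {l<..l + (n - Suc k)}" for x
      using that \<open>k < n\<close> by (intro image_eqI[where x = "l + n - x"]) auto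
    thus ?thesis using that by auto
  qed
  have mono: "strict_mono_on {..<n} ?q \<or> strict_antimono_on {..<n} ?q"
    by (auto simp: monotone_on_def)
  have full: "?q ` {..<n} = {l<..l + n}" by (simp add: downward_image)
  have "(\<Sum>T\<in>subsets_of_card {l<..l + n} m. occupation_weight p m T *
            g (card {a \<in> {l<..l + n}. {a..l + n} \<subseteq> T}))
      = (\<Sum>T\<in>subsets_of_card (?q ` {..<n}) m. occupation_weight p m T * g (end_run ?q T))"
    unfolding full
  proof (intro sum.cong refl)
    fix T assume T: "T \<in> subsets_of_card {l<..l + n} m"
    have "card {a \<in> {l<..l + n}. {a..l + n} \<subseteq> T} = end_run ?q T"
      unfolding trailing_run(1)[OF T m] using trailing_run(2)[OF T m] m by simp
    thus "occupation_weight p m T * g (card {a \<in> {l<..l + n}. {a..l + n} \<subseteq> T})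
        = occupation_weight p m T * g (end_run ?q T)" by (rule arg_cong)
  qed
  also have "\<dots> = (\<Sum>k\<le>m. real (m choose k) * total_weight p k (?q ` {..<k}) *
            total_weight p (m - k) (?q ` {k<..<n}) * g k)"
    by (rule sum_by_end_run[OF mono m])
  also have "\<dots> = (\<Sum>k\<le>m. real (m choose k) * parking_number k k *
            parking_number (m - k) (n - Suc k) * g k)"
  proof (rule sum.cong[OF refl])
    fix k assume "k \<in> {..m}"
    hence k: "k \<le> m" "k < n" using m by auto
    show "real (m choose k) * total_weight p k (?q ` {..<k}) *
            total_weight p (m - k) (?q ` {k<..<n}) * g k
        = real (m choose k) * parking_number k k * parking_number (m - k) (n - Suc k) * g k"
      unfolding downward_image[OF less_imp_le[OF k(2)]] q2[OF k(2)]
      using k m weight[of k k "l + n - k"] weight[of "m - k" "n - Suc k" l]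
      by simp
  qed
  finally show ?thesis .
qed

text \<open>
  One more car loses \<open>p\<close> times the trailing run plus \<open>1 - p\<close> times the leading run. By the induction
  hypothesis both runs have the same weighted total, which is free of \<open>p\<close>, so \<open>p\<close> cancels from
  the loss; Abel's identity evaluates it. The induction is over all intervals at once, since the
  part beyond an end run is a translated street.
\<close>

lemma total_weight_interval:
  assumes "m \<le> n"
  shows "total_weight p m {l<..l + n} = parking_number m n"
  using assms
proof (induction m arbitrary: l n rule: less_induct)
  case (less m)
  show ?case
  proof (cases m)
    case 0
    have "subsets_of_card {l<..l + n} 0 = {{}}"
      by (auto simp: subsets_of_card_def dest: finite_subset[OF _ finite_greaterThanAtMost])
    thus ?thesis using 0 by (simp add: total_weight_def parking_number_def)
  next
    case (Suc M)
    let ?I = "{l<..l + n}"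
    have M: "M < n" using less.prems Suc by simp
    have IH: "total_weight p k {l<..l + n} = parking_number k n" if "k \<le> M" "k \<le> n" for k l n
      using less.IH[of k n l] that Suc by simp
    have "total_weight p m ?I = (\<Sum>T\<in>subsets_of_card ?I M. occupation_weight p M T *
            (\<Sum>s\<in>?I - T. park_mass p T s * 1))"
      unfolding total_weight_def Suc
      using sum_add_car[where I = ?I and m = M and p = p and g = "\<lambda>_. 1"] by simp
    also have "\<dots> = (\<Sum>T\<in>subsets_of_card ?I M. real n * occupation_weight p M T
          - p * (occupation_weight p M T * real (card {a \<in> ?I. {a..l + n} \<subseteq> T}))
          - (1 - p) * (occupation_weight p M T * real (card {a \<in> ?I. {l<..a} \<subseteq> T})))"
      by (intro sum.cong refl, simp only: mult_1_right, subst sum_park_mass_free)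
         (auto simp: subsets_of_card_def algebra_simps)
    also have "\<dots> = real n * total_weight p M ?I
          - p * (\<Sum>T\<in>subsets_of_card ?I M. occupation_weight p M T * real (card {a \<in> ?I. {a..l + n} \<subseteq> T}))
          - (1 - p) * (\<Sum>T\<in>subsets_of_card ?I M. occupation_weight p M T * real (card {a \<in> ?I. {l<..a} \<subseteq> T}))"
      by (simp only: total_weight_def sum_subtractf sum_distrib_left)
    also have "\<dots> = real n * parking_number M n - real M * (real n + 1) ^ M / (real n + 1)"
    proof -
      let ?V = "real M * (real n + 1) ^ M / (real n + 1)"
      have R: "(\<Sum>T\<in>subsets_of_card ?I M. occupation_weight p M T *
                  real (card {a \<in> ?I. {a..l + n} \<subseteq> T})) = ?V"
        unfolding sum_run_length[OF M, symmetric] by (rule sum_by_trailing_run[OF M IH])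
      have L: "(\<Sum>T\<in>subsets_of_card ?I M. occupation_weight p M T *
                  real (card {a \<in> ?I. {l<..a} \<subseteq> T})) = ?V"
        unfolding sum_run_length[OF M, symmetric] by (rule sum_by_leading_run[OF M IH])
      have N: "total_weight p M ?I = parking_number M n" using IH M by simp
      have "x - p * v - (1 - p) * v = x - v" for x v :: real
        by (simp add: algebra_simps)
      thus ?thesis unfolding R L N .
    qed
    also have "\<dots> = parking_number m n"
    proof -
      have "x * ((x + 1 - y) * X / (x + 1)) - y * X / (x + 1) = (x + 1 - (1 + y)) * ((x + 1) * X) / (x + 1)"
        if "x \<ge> 0" for x y X :: real
      proof -
        have "x * ((x + 1 - y) * X) - y * X = (x + 1) * ((x - y) * X)"
          by (simp add: algebra_simps)
        hence "x * ((x + 1 - y) * X / (x + 1)) - y * X / (x + 1) = (x + 1) * ((x - y) * X) / (x + 1)"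
          by (metis diff_divide_distrib times_divide_eq_right)
        thus ?thesis using that by simp
      qed
      thus ?thesis unfolding parking_number_def Suc of_nat_Suc power_Suc by simp
    qed
    finally show ?thesis .
  qed
qed

section \<open>The parking process\<close>

lemma next_free_eq_Some_iff:
  assumes "s \<notin> S" "s \<le> n"
  shows "next_free n S a = Some s \<longleftrightarrow> a < s \<and> {a<..<s} \<subseteq> S"
proof
  assume "next_free n S a = Some s"
  hence ne: "{a<..n} - S \<noteq> {}" and Min: "Min ({a<..n} - S) = s"
    by (auto simp: next_free_def split: if_splits)
  have "s \<in> {a<..n} - S" using Min_in[OF _ ne] Min by auto
  moreover have "{a<..<s} \<subseteq> S"
  proof
    fix x assume x: "x \<in> {a<..<s}"
    show "x \<in> S"
    proof (rule ccontr)
      assume "x \<notin> S"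
      hence "s \<le> x" unfolding Min[symmetric] using x assms(2) by (intro Min_le) auto
      thus False using x by simp
    qed
  qed
  ultimately show "a < s \<and> {a<..<s} \<subseteq> S" by simp
next
  assume s: "a < s \<and> {a<..<s} \<subseteq> S"
  have mem: "s \<in> {a<..n} - S" using s assms by simp
  have "Min ({a<..n} - S) = s"
  proof (rule Min_eqI)
    fix x assume x: "x \<in> {a<..n} - S"
    show "s \<le> x"
    proof (rule ccontr)
      assume "\<not> s \<le> x"
      hence "x \<in> {a<..<s}" using x by simp
      thus False using s x by blast
    qed
  qed (use mem in auto)
  thus "next_free n S a = Some s" using mem by (auto simp: next_free_def)
qed

lemma prev_free_eq_Some_iff:
  assumes "s \<notin> S" "1 \<le> s"
  shows "prev_free S a = Some s \<longleftrightarrow> s < a \<and> {s<..<a} \<subseteq> S"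
proof
  assume "prev_free S a = Some s"
  hence ne: "{1..<a} - S \<noteq> {}" and Max: "Max ({1..<a} - S) = s"
    by (auto simp: prev_free_def split: if_splits)
  have "s \<in> {1..<a} - S" using Max_in[OF _ ne] Max by auto
  moreover have "{s<..<a} \<subseteq> S"
  proof
    fix x assume x: "x \<in> {s<..<a}"
    show "x \<in> S"
    proof (rule ccontr)
      assume "x \<notin> S"
      hence "x \<le> s" unfolding Max[symmetric] using x assms(2) by (intro Max_ge) auto
      thus False using x by simp
    qed
  qed
  ultimately show "s < a \<and> {s<..<a} \<subseteq> S" by simp
next
  assume s: "s < a \<and> {s<..<a} \<subseteq> S"
  have mem: "s \<in> {1..<a} - S" using s assms by simp
  have "Max ({1..<a} - S) = s"
  proof (rule Max_eqI)
    fix x assume x: "x \<in> {1..<a} - S"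
    show "x \<le> s"
    proof (rule ccontr)
      assume "\<not> x \<le> s"
      hence "x \<in> {s<..<a}" using x by simp
      thus False using s x by blast
    qed
  qed (use mem in auto)
  thus "prev_free S a = Some s" using mem by (auto simp: prev_free_def)
qed

lemma pmf_park_car:
  assumes "0 \<le> p" "p \<le> 1"
  shows "pmf (park_car n p S a) x =
     (if a \<notin> S then of_bool (x = Some a)
      else p * of_bool (next_free n S a = x) + (1 - p) * of_bool (prev_free S a = x))"
proof (cases "a \<in> S")
  case False
  thus ?thesis by (auto simp: park_car_def)
next
  case True
  have "pmf (park_car n p S a) x
      = measure_pmf.expectation (bernoulli_pmf p)
          (\<lambda>f. pmf (return_pmf (if f then next_free n S a else prev_free S a)) x)"
    using True by (simp add: park_car_def map_pmf_def pmf_bind)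
  also have "\<dots> = p * of_bool (next_free n S a = x) + (1 - p) * of_bool (prev_free S a = x)"
    using assms by (simp add: indicator_def mult.commute)
  finally show ?thesis using True by simp
qed

lemma pmf_park_car_Some:
  assumes "0 \<le> p" "p \<le> 1" and s: "s \<in> {0<..n} - S"
  shows "pmf (park_car n p S a) (Some s)
       = of_bool (a = s) + p * of_bool (a < s \<and> {a..<s} \<subseteq> S)
         + (1 - p) * of_bool (s < a \<and> {s<..a} \<subseteq> S)"
proof (cases "a \<in> S")
  case True
  have "{a..<s} \<subseteq> S \<longleftrightarrow> {a<..<s} \<subseteq> S" if "a < s"
  proof -
    have "{a..<s} = insert a {a<..<s}" using that by auto
    thus ?thesis using True by simp
  qed
  moreover have "{s<..a} \<subseteq> S \<longleftrightarrow> {s<..<a} \<subseteq> S" if "s < a"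
  proof -
    have "{s<..a} = insert a {s<..<a}" using that by auto
    thus ?thesis using True by simp
  qed
  ultimately show ?thesis
    using True s next_free_eq_Some_iff[of s S n a] prev_free_eq_Some_iff[of s S a]
    by (auto simp: pmf_park_car[OF assms(1,2)])
next
  case False
  have "\<not> (a < s \<and> {a..<s} \<subseteq> S)" "\<not> (s < a \<and> {s<..a} \<subseteq> S)"
    using False by auto
  thus ?thesis using False s by (auto simp: pmf_park_car[OF assms(1,2)])
qed

lemma pmf_park_car_None:
  assumes "0 \<le> p" "p \<le> 1" and a: "a \<in> {0<..n}"
  shows "pmf (park_car n p S a) None
       = p * of_bool ({a..n} \<subseteq> S) + (1 - p) * of_bool ({0<..a} \<subseteq> S)"
proof (cases "a \<in> S")
  case True
  have "{a..n} = insert a {a<..n}" "{0<..a} = insert a {1..<a}" using a by auto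
  hence "{a..n} \<subseteq> S \<longleftrightarrow> {a<..n} - S = {}" "{0<..a} \<subseteq> S \<longleftrightarrow> {1..<a} - S = {}"
    using True by auto
  thus ?thesis using True
    by (simp add: pmf_park_car[OF assms(1,2)] next_free_def prev_free_def)
next
  case False
  moreover have "a \<in> {a..n}" "a \<in> {0<..a}" using a by auto
  ultimately have "\<not> {a..n} \<subseteq> S" "\<not> {0<..a} \<subseteq> S" by blast+
  thus ?thesis using False by (simp add: pmf_park_car[OF assms(1,2)])
qed

lemma set_pmf_park_car:
  assumes a: "a \<in> {0<..n}"
  shows "set_pmf (park_car n p S a) \<subseteq> insert None (Some ` ({0<..n} - S))"
proof -
  have "next_free n S a \<in> insert None (Some ` ({0<..n} - S))"
  proof (cases "{a<..n} - S = {}")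
    case False
    hence "Min ({a<..n} - S) \<in> {a<..n} - S" by (intro Min_in) auto
    thus ?thesis using False by (auto simp: next_free_def)
  qed (simp add: next_free_def)
  moreover have "prev_free S a \<in> insert None (Some ` ({0<..n} - S))"
  proof (cases "{1..<a} - S = {}")
    case False
    hence "Max ({1..<a} - S) \<in> {1..<a} - S" by (intro Max_in) auto
    thus ?thesis using False a by (auto simp: prev_free_def)
  qed (simp add: prev_free_def)
  ultimately show ?thesis using a by (auto simp: park_car_def)
qed

lemma sum_pmf_park_car:
  assumes "0 \<le> p" "p \<le> 1" and S: "S \<subseteq> {0<..n}" and s: "s \<in> {0<..n} - S"
  shows "(\<Sum>a\<in>{0<..n}. pmf (park_car n p S a) (Some s)) = park_mass p S s"
proof -
  let ?B = "{a. a < s \<and> {a..<s} \<subseteq> S}" and ?F = "{a. s < a \<and> {s<..a} \<subseteq> S}"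
  have B: "{0<..n} \<inter> ?B = ?B"
  proof -
    have "a \<in> {0<..n}" if "a \<in> ?B" for a
    proof -
      have "a \<in> {a..<s}" using that by simp
      thus ?thesis using that S by blast
    qed
    thus ?thesis by blast
  qed
  have F: "{0<..n} \<inter> ?F = ?F"
  proof -
    have "a \<in> {0<..n}" if "a \<in> ?F" for a
    proof -
      have "a \<in> {s<..a}" using that by simp
      thus ?thesis using that S by blast
    qed
    thus ?thesis by blast
  qed
  have "(\<Sum>a\<in>{0<..n}. pmf (park_car n p S a) (Some s))
     = (\<Sum>a\<in>{0<..n}. of_bool (a = s)) + p * (\<Sum>a\<in>{0<..n}. of_bool (a < s \<and> {a..<s} \<subseteq> S))
       + (1 - p) * (\<Sum>a\<in>{0<..n}. of_bool (s < a \<and> {s<..a} \<subseteq> S))"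
    unfolding pmf_park_car_Some[OF assms(1,2) s] by (simp add: sum.distrib sum_distrib_left)
  also have "(\<Sum>a\<in>{0<..n}. of_bool (a = s)) = (1::real)"
    using s by (simp add: of_bool_def sum.delta)
  also have "(\<Sum>a\<in>{0<..n}. of_bool (a < s \<and> {a..<s} \<subseteq> S)) = real (card ?B)"
    by (subst sum_of_bool_eq) (simp_all only: B finite_greaterThanAtMost)
  also have "(\<Sum>a\<in>{0<..n}. of_bool (s < a \<and> {s<..a} \<subseteq> S)) = real (card ?F)"
    by (subst sum_of_bool_eq) (simp_all only: F finite_greaterThanAtMost)
  finally show ?thesis unfolding park_mass_def .
qed

definition park_prob :: "nat \<Rightarrow> real \<Rightarrow> nat set \<Rightarrow> nat list \<Rightarrow> real" where
  "park_prob n p S \<alpha> = measure_pmf.prob (park_cars n p S \<alpha>) {ss. None \<notin> set ss}"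

lemma finite_set_pmf_park_cars: "finite (set_pmf (park_cars n p S \<alpha>))"
proof (induction \<alpha> arbitrary: S)
  case (Cons a \<alpha>)
  have "finite (set_pmf (park_car n p S a))" by (simp add: park_car_def)
  thus ?case using Cons.IH by simp
qed simp

lemma park_prob_Nil [simp]: "park_prob n p S [] = 1"
  by (simp add: park_prob_def)

text \<open>
  Only the branches in which the first car parks contribute, so failed attempts drop out and
  a finite sum over free spots remains.
\<close>

lemma park_prob_Cons:
  assumes a: "a \<in> {0<..n}"
  shows "park_prob n p S (a # \<alpha>)
       = (\<Sum>s\<in>{0<..n} - S. pmf (park_car n p S a) (Some s) * park_prob n p (insert s S) \<alpha>)"
proof -
  let ?A = "insert None (Some ` ({0<..n} - S))"
  let ?rest = "\<lambda>s. map_pmf ((#) s) (park_cars n p (S \<union> set_option s) \<alpha>)"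
  have e: "park_cars n p S (a # \<alpha>) = bind_pmf (park_car n p S a) ?rest"
    by (simp add: map_pmf_def)
  have "park_prob n p S (a # \<alpha>)
      = measure_pmf.expectation (bind_pmf (park_car n p S a) ?rest) (indicator {ss. None \<notin> set ss})"
    unfolding park_prob_def e by simp
  also have "\<dots> = (\<Sum>s\<in>?A. pmf (park_car n p S a) s *\<^sub>R
      measure_pmf.expectation (?rest s) (indicator {ss. None \<notin> set ss}))"
    by (rule pmf_expectation_bind) (use set_pmf_park_car[OF a] finite_set_pmf_park_cars in auto)
  also have "\<dots> = (\<Sum>s\<in>?A. pmf (park_car n p S a) s *
      measure_pmf.prob (park_cars n p (S \<union> set_option s) \<alpha>) ((#) s -` {ss. None \<notin> set ss}))"
    by simp
  also have "\<dots> = (\<Sum>s\<in>Some ` ({0<..n} - S). pmf (park_car n p S a) s *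
      measure_pmf.prob (park_cars n p (S \<union> set_option s) \<alpha>) ((#) s -` {ss. None \<notin> set ss}))"
    by (subst sum.insert) auto
  also have "\<dots> = (\<Sum>s\<in>{0<..n} - S. pmf (park_car n p S a) (Some s) * park_prob n p (insert s S) \<alpha>)"
    by (subst sum.reindex) (auto simp: park_prob_def vimage_def)
  finally show ?thesis .
qed

lemma park_prob_singleton:
  assumes "0 \<le> p" "p \<le> 1" and a: "a \<in> {0<..n}"
  shows "park_prob n p S [a] = 1 - p * of_bool ({a..n} \<subseteq> S) - (1 - p) * of_bool ({0<..a} \<subseteq> S)"
proof -
  have "1 = (\<Sum>x\<in>insert None (Some ` ({0<..n} - S)). pmf (park_car n p S a) x)"
    by (rule sum_pmf_eq_1[symmetric]) (use set_pmf_park_car[OF a] in auto)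
  also have "\<dots> = pmf (park_car n p S a) None + park_prob n p S [a]"
    unfolding park_prob_Cons[OF a] by (subst sum.insert) (auto simp: sum.reindex)
  finally show ?thesis unfolding pmf_park_car_None[OF assms] by simp
qed

lemma finite_preference_lists: "finite (preference_lists m n)"
  using finite_lists_length_eq[of "{1..n}" m] by (simp add: preference_lists_def conj_commute)

lemma sum_preference_lists_Cons:
  fixes f :: "nat list \<Rightarrow> real"
  shows "(\<Sum>\<alpha>\<in>preference_lists (Suc m) n. f \<alpha>)
       = (\<Sum>a\<in>{0<..n}. \<Sum>\<beta>\<in>preference_lists m n. f (a # \<beta>))"
proof -
  have "(\<Sum>\<alpha>\<in>preference_lists (Suc m) n. f \<alpha>)
      = (\<Sum>(a,\<beta>)\<in>{0<..n} \<times> preference_lists m n. f (a # \<beta>))"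
    by (rule sum.reindex_bij_witness[where i = "\<lambda>(a,\<beta>). a # \<beta>" and j = "\<lambda>\<alpha>. (hd \<alpha>, tl \<alpha>)"])
       (auto simp: preference_lists_def length_Suc_conv)
  thus ?thesis by (simp add: sum.cartesian_product)
qed

lemma sum_preference_lists_snoc:
  fixes f :: "nat list \<Rightarrow> real"
  shows "(\<Sum>\<alpha>\<in>preference_lists (Suc m) n. f \<alpha>)
       = (\<Sum>a\<in>{0<..n}. \<Sum>\<beta>\<in>preference_lists m n. f (\<beta> @ [a]))"
proof -
  have "(\<Sum>\<alpha>\<in>preference_lists (Suc m) n. f \<alpha>)
      = (\<Sum>(a,\<beta>)\<in>{0<..n} \<times> preference_lists m n. f (\<beta> @ [a]))"
    by (rule sum.reindex_bij_witness[where i = "\<lambda>(a,\<beta>). \<beta> @ [a]" and j = "\<lambda>\<alpha>. (last \<alpha>, butlast \<alpha>)"])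
       (auto simp: preference_lists_def length_Suc_conv_rev)
  thus ?thesis by (simp add: sum.cartesian_product)
qed

text \<open>
  The protocol runs from the first car, the occupation weights from the last. Moving the cars of
  the list one at a time from \<open>park_prob\<close> into the weight connects the two; the remaining
  cars \<open>\<gamma>\<close> are carried along.
\<close>

lemma sum_park_prob_append:
  assumes p: "0 \<le> p" "p \<le> 1"
  shows "(\<Sum>S\<in>subsets_of_card {0<..n} j. occupation_weight p j S *
            (\<Sum>\<beta>\<in>preference_lists k n. park_prob n p S (\<beta> @ \<gamma>)))
       = (\<Sum>T\<in>subsets_of_card {0<..n} (j + k). occupation_weight p (j + k) T * park_prob n p T \<gamma>)"
proof (induction k arbitrary: j)
  case 0
  have "preference_lists 0 n = {[]}" by (auto simp: preference_lists_def)
  thus ?case by simp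
next
  case (Suc k)
  have "(\<Sum>\<beta>\<in>preference_lists (Suc k) n. park_prob n p S (\<beta> @ \<gamma>))
      = (\<Sum>s\<in>{0<..n} - S. park_mass p S s *
           (\<Sum>\<beta>\<in>preference_lists k n. park_prob n p (insert s S) (\<beta> @ \<gamma>)))"
    if S: "S \<in> subsets_of_card {0<..n} j" for S
  proof -
    have "(\<Sum>\<beta>\<in>preference_lists (Suc k) n. park_prob n p S (\<beta> @ \<gamma>))
        = (\<Sum>a\<in>{0<..n}. \<Sum>\<beta>\<in>preference_lists k n. \<Sum>s\<in>{0<..n} - S.
             pmf (park_car n p S a) (Some s) * park_prob n p (insert s S) (\<beta> @ \<gamma>))"
      unfolding sum_preference_lists_Cons by (simp add: park_prob_Cons)
    also have "\<dots> = (\<Sum>a\<in>{0<..n}. \<Sum>s\<in>{0<..n} - S. \<Sum>\<beta>\<in>preference_lists k n.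
             pmf (park_car n p S a) (Some s) * park_prob n p (insert s S) (\<beta> @ \<gamma>))"
      by (intro sum.cong refl sum.swap)
    also have "\<dots> = (\<Sum>s\<in>{0<..n} - S. \<Sum>a\<in>{0<..n}. \<Sum>\<beta>\<in>preference_lists k n.
             pmf (park_car n p S a) (Some s) * park_prob n p (insert s S) (\<beta> @ \<gamma>))"
      by (rule sum.swap)
    also have "\<dots> = (\<Sum>s\<in>{0<..n} - S. (\<Sum>a\<in>{0<..n}. pmf (park_car n p S a) (Some s)) *
             (\<Sum>\<beta>\<in>preference_lists k n. park_prob n p (insert s S) (\<beta> @ \<gamma>)))"
      by (simp only: sum_product)
    also have "\<dots> = (\<Sum>s\<in>{0<..n} - S. park_mass p S s *
           (\<Sum>\<beta>\<in>preference_lists k n. park_prob n p (insert s S) (\<beta> @ \<gamma>)))"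
      using S by (intro sum.cong refl, subst sum_pmf_park_car[OF p]) (auto simp: subsets_of_card_def)
    finally show ?thesis .
  qed
  hence "(\<Sum>S\<in>subsets_of_card {0<..n} j. occupation_weight p j S *
            (\<Sum>\<beta>\<in>preference_lists (Suc k) n. park_prob n p S (\<beta> @ \<gamma>)))
      = (\<Sum>S\<in>subsets_of_card {0<..n} j. occupation_weight p j S *
            (\<Sum>s\<in>{0<..n} - S. park_mass p S s *
               (\<Sum>\<beta>\<in>preference_lists k n. park_prob n p (insert s S) (\<beta> @ \<gamma>))))"
    by simp
  also have "\<dots> = (\<Sum>S\<in>subsets_of_card {0<..n} (Suc j). occupation_weight p (Suc j) S *
               (\<Sum>\<beta>\<in>preference_lists k n. park_prob n p S (\<beta> @ \<gamma>)))"
    by (rule sum_add_car) simp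
  also have "\<dots> = (\<Sum>T\<in>subsets_of_card {0<..n} (Suc j + k).
               occupation_weight p (Suc j + k) T * park_prob n p T \<gamma>)"
    by (rule Suc.IH)
  finally show ?case by simp
qed

lemma sum_park_prob_snoc:
  assumes p: "0 \<le> p" "p \<le> 1" and a: "a \<in> {0<..n}"
  shows "(\<Sum>\<beta>\<in>preference_lists M n. park_prob n p {} (\<beta> @ [a]))
       = (\<Sum>T\<in>subsets_of_card {0<..n} M. occupation_weight p M T *
            (1 - p * of_bool ({a..n} \<subseteq> T) - (1 - p) * of_bool ({0<..a} \<subseteq> T)))"
proof -
  have "subsets_of_card {0<..n} 0 = {{}}"
    by (auto simp: subsets_of_card_def dest: finite_subset[OF _ finite_greaterThanAtMost])
  thus ?thesis
    using sum_park_prob_append[OF p, where n = n and j = 0 and k = M and \<gamma> = "[a]"] by (simp add: park_prob_singleton[OF p a])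
qed

text \<open>
  The uniform law of the preference list contributes the same factor to the expectation on the event
  that all cars park and to the probability of this event, so it cancels from the conditional
  expectation. The last preference is then split off from the list.
\<close>

lemma expected_last_preference_eq:
  assumes m: "Suc M \<le> n"
  shows "expected_last_preference (Suc M) n p
      = (\<Sum>a\<in>{0<..n}. real a * (\<Sum>\<beta>\<in>preference_lists M n. park_prob n p {} (\<beta> @ [a])))
        / (\<Sum>a\<in>{0<..n}. \<Sum>\<beta>\<in>preference_lists M n. park_prob n p {} (\<beta> @ [a]))"
proof -
  let ?P = "parking_pmf (Suc M) n p" and ?L = "preference_lists (Suc M) n"
  let ?run = "\<lambda>\<alpha>. map_pmf (Pair \<alpha>) (park_cars n p {} \<alpha>)"
  note ne = parking_pmf_all_parked[OF m, of p]
  have P: "?P = bind_pmf (pmf_of_set ?L) ?run"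
    unfolding parking_pmf_def by (simp add: map_pmf_def)
  have "replicate (Suc M) 1 \<in> ?L" using m by (auto simp: preference_lists_def)
  hence L: "?L \<noteq> {}" "finite ?L" by (auto simp: finite_preference_lists)
  have finP: "finite (set_pmf ?P)"
    unfolding P using L finite_set_pmf_park_cars by simp
  have E: "measure_pmf.expectation ?P (\<lambda>x. g (fst x) * indicator all_parked x)
         = (\<Sum>\<alpha>\<in>?L. g \<alpha> * park_prob n p {} \<alpha>) / real (card ?L)" for g :: "nat list \<Rightarrow> real"
  proof -
    have "measure_pmf.expectation ?P (\<lambda>x. g (fst x) * indicator all_parked x)
       = (\<Sum>\<alpha>\<in>?L. measure_pmf.expectation (?run \<alpha>) (\<lambda>x. g (fst x) * indicator all_parked x)
            /\<^sub>R real (card ?L))"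
      unfolding P by (rule pmf_expectation_bind_pmf_of_set[OF L]) (simp add: finite_set_pmf_park_cars)
    also have "\<dots> = (\<Sum>\<alpha>\<in>?L. g \<alpha> * park_prob n p {} \<alpha> / real (card ?L))"
    proof (rule sum.cong[OF refl])
      fix \<alpha>
      have "(\<lambda>ss. g \<alpha> * indicator all_parked (\<alpha>, ss)) = (\<lambda>ss. g \<alpha> * indicator {ss. None \<notin> set ss} ss)"
        by (auto simp: all_parked_def indicator_def)
      hence "measure_pmf.expectation (?run \<alpha>) (\<lambda>x. g (fst x) * indicator all_parked x)
          = g \<alpha> * park_prob n p {} \<alpha>"
        by (simp add: park_prob_def)
      thus "measure_pmf.expectation (?run \<alpha>) (\<lambda>x. g (fst x) * indicator all_parked x) /\<^sub>R real (card ?L)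
          = g \<alpha> * park_prob n p {} \<alpha> / real (card ?L)"
        by (simp add: divide_inverse mult.commute)
    qed
    finally show ?thesis by (simp add: sum_divide_distrib)
  qed
  have den: "measure_pmf.prob ?P all_parked = (\<Sum>\<alpha>\<in>?L. park_prob n p {} \<alpha>) / real (card ?L)"
    using E[of "\<lambda>_. 1"] by simp
  have "expected_last_preference (Suc M) n p
      = (\<Sum>x\<in>set_pmf ?P. pmf (cond_pmf ?P all_parked) x *\<^sub>R real (fst x ! M))"
    unfolding expected_last_preference_def
    by (subst integral_measure_pmf[OF finP]) (use ne in \<open>auto simp: case_prod_beta set_cond_pmf\<close>)
  also have "\<dots> = (\<Sum>x\<in>set_pmf ?P. pmf ?P x *\<^sub>R (real (fst x ! M) * indicator all_parked x))
       / measure_pmf.prob ?P all_parked"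
    unfolding sum_divide_distrib
    by (intro sum.cong refl) (simp add: pmf_cond[OF ne])
  also have "(\<Sum>x\<in>set_pmf ?P. pmf ?P x *\<^sub>R (real (fst x ! M) * indicator all_parked x))
      = measure_pmf.expectation ?P (\<lambda>x. real (fst x ! M) * indicator all_parked x)"
    by (rule integral_measure_pmf[OF finP, symmetric]) auto
  also have "\<dots> / measure_pmf.prob ?P all_parked
      = (\<Sum>\<alpha>\<in>?L. real (\<alpha> ! M) * park_prob n p {} \<alpha>) / (\<Sum>\<alpha>\<in>?L. park_prob n p {} \<alpha>)"
    unfolding E[of "\<lambda>\<alpha>. real (\<alpha> ! M)"] den using L by simp
  also have "(\<Sum>\<alpha>\<in>?L. real (\<alpha> ! M) * park_prob n p {} \<alpha>)
      = (\<Sum>a\<in>{0<..n}. real a * (\<Sum>\<beta>\<in>preference_lists M n. park_prob n p {} (\<beta> @ [a])))"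
    unfolding sum_preference_lists_snoc sum_distrib_left
    by (intro sum.cong refl) (auto simp: preference_lists_def nth_append)
  finally show ?thesis unfolding sum_preference_lists_snoc .
qed

section \<open>The expected last preference\<close>

lemma sum_first_spots: "(\<Sum>a\<in>{0<..k}. real a) = real k * (real k + 1) / 2"
proof (induction k)
  case (Suc k)
  have "{0<..Suc k} = insert (Suc k) {0<..k}" by auto
  thus ?case using Suc by (simp add: field_simps)
qed simp

lemma sum_last_spots:
  "k \<le> n \<Longrightarrow> (\<Sum>a\<in>{n - k<..n}. real a) = real k * (real n + 1) - real k * (real k + 1) / 2"
proof (induction k)
  case (Suc k)
  have "{n - Suc k<..n} = insert (n - k) {n - k<..n}" using Suc.prems by auto
  thus ?case using Suc by (simp add: field_simps of_nat_diff)
qed simp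

text \<open>
  Up to an explicit factor, the weighted total of \<open>k (k + 1) / 2\<close> over the lengths \<open>k\<close> of the end runs left by
  \<open>N + 1\<close> cars on \<open>n\<close> spots.
\<close>

definition run_sum :: "nat \<Rightarrow> nat \<Rightarrow> real" where
  "run_sum N n = (\<Sum>i\<le>N. (\<Prod>t<i. (real N - real t) / (real n + 1)) * (2 + real i))"

text \<open>
  By \<open>sum_park_prob_snoc\<close> the last preference deviates from the uniform law only on the
  two end runs of the other \<open>N + 1\<close> cars. Summing \<open>a\<close> over a leading run of length \<open>k\<close> gives
  \<open>k (k + 1) / 2\<close>, and over a trailing run \<open>k (n + 1)\<close> minus that, so the first two moments of
  the run length suffice. These are the same for both runs, hence the bias is odd under
  the exchange of \<open>p\<close> and \<open>1 - p\<close>.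
\<close>

lemma expected_last_preference_exact:
  assumes p: "0 \<le> p" "p \<le> 1" and n: "Suc (Suc N) \<le> n"
  shows "expected_last_preference (Suc (Suc N)) n p
       = (real n + 1) / 2 - (2 * p - 1) * (real (Suc N) / (2 * (real n - real (Suc N)))
           * (1 - run_sum N n / (real n + 1)))"
proof -
  define M where "M = Suc N"
  let ?I = "{0<..n}"
  let ?S = "subsets_of_card ?I M"
  let ?w = "occupation_weight p M"
  define L where "L T = card {a \<in> {0<..n}. {0<..a} \<subseteq> T}" for T
  define R where "R T = card {a \<in> {0<..n}. {a..n} \<subseteq> T}" for T
  have Mn: "M < n" using n by (simp add: M_def)
  have leading: "{a \<in> ?I. {0<..a} \<subseteq> T} = {0<..L T}" if "T \<in> ?S" for T
    using leading_run[of T 0 n M] that Mn by (simp add: L_def)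
  have trailing: "{a \<in> ?I. {a..n} \<subseteq> T} = {n - R T<..n}" and R_le: "R T \<le> n" if "T \<in> ?S" for T
    using trailing_run[of T 0 n M] that Mn by (simp_all add: R_def)
  have sum0: "(\<Sum>a\<in>?I. 1 - p * of_bool ({a..n} \<subseteq> T) - (1 - p) * of_bool ({0<..a} \<subseteq> T))
      = real n - p * real (R T) - (1 - p) * real (L T)" for T
    by (simp add: sum_subtractf sum_distrib_left[symmetric] sum_of_bool_eq Int_def R_def L_def)
  have sum1: "(\<Sum>a\<in>?I. real a * (1 - p * of_bool ({a..n} \<subseteq> T) - (1 - p) * of_bool ({0<..a} \<subseteq> T)))
      = real n * (real n + 1) / 2
        - p * (real (R T) * (real n + 1) - real (R T) * (real (R T) + 1) / 2)
        - (1 - p) * (real (L T) * (real (L T) + 1) / 2)" if T: "T \<in> ?S" for T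
  proof -
    have "(\<Sum>a\<in>?I. real a * (1 - p * of_bool ({a..n} \<subseteq> T) - (1 - p) * of_bool ({0<..a} \<subseteq> T)))
        = (\<Sum>a\<in>?I. real a) - p * (\<Sum>a\<in>?I. real a * of_bool ({a..n} \<subseteq> T))
          - (1 - p) * (\<Sum>a\<in>?I. real a * of_bool ({0<..a} \<subseteq> T))"
      unfolding sum_distrib_left sum_subtractf[symmetric]
      by (intro sum.cong refl) (simp add: algebra_simps)
    also have "(\<Sum>a\<in>?I. real a * of_bool ({a..n} \<subseteq> T)) = (\<Sum>a\<in>{a \<in> ?I. {a..n} \<subseteq> T}. real a)"
      unfolding sum.inter_filter[OF finite_greaterThanAtMost] by (intro sum.cong) auto
    also have "(\<Sum>a\<in>?I. real a * of_bool ({0<..a} \<subseteq> T)) = (\<Sum>a\<in>{a \<in> ?I. {0<..a} \<subseteq> T}. real a)"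
      unfolding sum.inter_filter[OF finite_greaterThanAtMost] by (intro sum.cong) auto
    finally show ?thesis
      unfolding leading[OF T] trailing[OF T] sum_first_spots sum_last_spots[OF R_le[OF T]] .
  qed
  define z where "z = real n + 1"
  define X where "X = z ^ N"
  define s where "s = run_sum N n"
  have z: "z > 0" by (simp add: z_def)
  have X: "X > 0" using z by (simp add: X_def)
  have weight: "total_weight p k {l<..l + n'} = parking_number k n'" if "k \<le> n'" for k l n'
    using that by (rule total_weight_interval)
  have S0: "(\<Sum>T\<in>?S. ?w T) = (z - real M) * X"
    using weight[of M n 0] Mn z
    by (simp add: total_weight_def parking_number_def z_def[symmetric] M_def X_def)
  have run: "real M * (real n + 1) ^ M / (real n + 1) = real M * X"
    using z by (simp add: z_def[symmetric] M_def X_def)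
  have S1L: "(\<Sum>T\<in>?S. ?w T * real (L T)) = real M * X"
    using sum_by_leading_run[OF Mn weight, where l = 0 and g = real] sum_run_length[OF Mn] run
    by (simp add: L_def)
  have S1R: "(\<Sum>T\<in>?S. ?w T * real (R T)) = real M * X"
    using sum_by_trailing_run[OF Mn weight, where l = 0 and g = real] sum_run_length[OF Mn] run
    by (simp add: R_def)
  have tri: "(\<Sum>k\<le>M. real (M choose k) * parking_number k k * parking_number (M - k) (n - Suc k)
        * (real k * (real k + 1) / 2)) = real M / 2 * (X * s)"
    using sum_run_length_triangular[of N n] Mn unfolding M_def X_def z_def s_def run_sum_def by simp
  have S2L: "(\<Sum>T\<in>?S. ?w T * (real (L T) * (real (L T) + 1) / 2)) = real M / 2 * (X * s)"
    unfolding tri[symmetric] L_def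
    using sum_by_leading_run[OF Mn weight, where l = 0 and g = "\<lambda>k. real k * (real k + 1) / 2"]
    by simp
  have S2R: "(\<Sum>T\<in>?S. ?w T * (real (R T) * (real (R T) + 1) / 2)) = real M / 2 * (X * s)"
    unfolding tri[symmetric] R_def
    using sum_by_trailing_run[OF Mn weight, where l = 0 and g = "\<lambda>k. real k * (real k + 1) / 2"]
    by simp
  \<comment> \<open>the probability that the last car parks when it prefers \<open>a\<close> and \<open>T\<close> is occupied\<close>
  let ?\<phi> = "\<lambda>a T. 1 - p * of_bool ({a..n} \<subseteq> T) - (1 - p) * of_bool ({0<..a} \<subseteq> T)"
  have "(\<Sum>a\<in>?I. \<Sum>\<beta>\<in>preference_lists M n. park_prob n p {} (\<beta> @ [a]))
      = (\<Sum>a\<in>?I. \<Sum>T\<in>?S. ?w T * ?\<phi> a T)"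
    by (intro sum.cong refl sum_park_prob_snoc[OF p])
  also have "\<dots> = (\<Sum>T\<in>?S. ?w T * (\<Sum>a\<in>?I. ?\<phi> a T))"
    by (subst sum.swap) (simp only: sum_distrib_left)
  also have "\<dots> = (\<Sum>T\<in>?S. real n * ?w T - p * (?w T * real (R T)) - (1 - p) * (?w T * real (L T)))"
    unfolding sum0 by (intro sum.cong refl) (simp add: algebra_simps)
  also have "\<dots> = real n * ((z - real M) * X) - p * (real M * X) - (1 - p) * (real M * X)"
    by (simp only: sum_subtractf sum_distrib_left[symmetric] S0 S1L S1R)
  also have "\<dots> = X * z * (real n - real M)"
    unfolding z_def by (simp add: algebra_simps)
  finally have den: "(\<Sum>a\<in>?I. \<Sum>\<beta>\<in>preference_lists M n. park_prob n p {} (\<beta> @ [a]))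
      = X * z * (real n - real M)" .
  have "(\<Sum>a\<in>?I. real a * (\<Sum>\<beta>\<in>preference_lists M n. park_prob n p {} (\<beta> @ [a])))
      = (\<Sum>a\<in>?I. \<Sum>T\<in>?S. ?w T * (real a * ?\<phi> a T))"
    by (intro sum.cong refl) (simp only: sum_park_prob_snoc[OF p] sum_distrib_left mult.left_commute)
  also have "\<dots> = (\<Sum>T\<in>?S. ?w T * (\<Sum>a\<in>?I. real a * ?\<phi> a T))"
    by (subst sum.swap) (simp only: sum_distrib_left)
  also have "\<dots> = (\<Sum>T\<in>?S. real n * (real n + 1) / 2 * ?w T
        - p * (z * (?w T * real (R T)) - ?w T * (real (R T) * (real (R T) + 1) / 2))
        - (1 - p) * (?w T * (real (L T) * (real (L T) + 1) / 2)))"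
    by (intro sum.cong refl, subst sum1) (simp_all add: z_def algebra_simps)
  also have "\<dots> = real n * (real n + 1) / 2 * ((z - real M) * X)
        - p * (z * (real M * X) - real M / 2 * (X * s)) - (1 - p) * (real M / 2 * (X * s))"
    by (simp only: sum_subtractf sum_distrib_left[symmetric] S0 S1R S2L S2R)
  also have "\<dots> = z / 2 * (X * z * (real n - real M)) - (2 * p - 1) * (real M / 2) * X * (z - s)"
    unfolding z_def by (simp add: field_simps)
  finally have num: "(\<Sum>a\<in>?I. real a * (\<Sum>\<beta>\<in>preference_lists M n. park_prob n p {} (\<beta> @ [a])))
      = z / 2 * (X * z * (real n - real M)) - (2 * p - 1) * (real M / 2) * X * (z - s)" .
  have "expected_last_preference (Suc M) n p
      = (z / 2 * (X * z * (real n - real M)) - (2 * p - 1) * (real M / 2) * X * (z - s))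
        / (X * z * (real n - real M))"
    using expected_last_preference_eq[of M n p] Mn by (simp only: num den)
  also have "\<dots> = z / 2 - (2 * p - 1) * (real M / (2 * (real n - real M)) * (1 - s / z))"
    using X z Mn by (simp add: field_simps)
  finally show ?thesis unfolding M_def z_def s_def .
qed

text \<open>
  Each factor falls short of \<open>c\<close> by \<open>(c + 2 + t) / (n + 1)\<close>, so the product differs from
  \<open>c ^ i\<close> by a quadratic in \<open>i\<close> times \<open>c ^ i / n\<close>. From \<open>i = N + 1\<close> on the product contains the factor
  \<open>t = N\<close> and vanishes, so the bound holds for every \<open>i\<close> and no tail has to be treated apart.
\<close>

lemma run_factor_approx:
  fixes c :: real
  assumes c: "0 < c" "c < 1" and N: "c * real n = real (Suc (Suc N))"
  defines "P \<equiv> \<lambda>i. \<Prod>t<i. (real N - real t) / (real n + 1)"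
  shows "0 \<le> c ^ i - P i \<and> c ^ i - P i \<le> real i * (real i + 3) * c ^ i / (c * (real n + 1))"
proof (induction i)
  case 0
  show ?case by (simp add: P_def)
next
  case (Suc i)
  define z where "z = real n + 1"
  have z: "z > 0" by (simp add: z_def)
  have P0: "0 \<le> P i"
  proof (cases "i \<le> N")
    case True
    thus ?thesis unfolding P_def by (intro prod_nonneg) auto
  next
    case False
    thus ?thesis unfolding P_def by (subst prod_zero) (auto intro!: bexI[of _ N])
  qed
  have gap: "c - (real N - real i) / z = (c + 2 + real i) / z"
    using N z by (simp add: z_def field_simps)
  have gap0: "0 \<le> (c + 2 + real i) / z" using z c by simp
  have gap1: "(c + 2 + real i) / z \<le> (real i + 3) / z"
    using z c by (intro divide_right_mono) auto
  have "c ^ Suc i - P (Suc i) = c * (c ^ i - P i) + P i * (c - (real N - real i) / z)"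
    unfolding P_def z_def by (simp add: algebra_simps)
  hence e: "c ^ Suc i - P (Suc i) = c * (c ^ i - P i) + P i * ((c + 2 + real i) / z)"
    unfolding gap .
  have "c * (c ^ i - P i) \<le> c * (real i * (real i + 3) * c ^ i / (c * z))"
    using Suc.IH c unfolding z_def by (intro mult_left_mono) auto
  moreover have "P i * ((c + 2 + real i) / z) \<le> c ^ i * ((real i + 3) / z)"
    using Suc.IH gap0 gap1 c by (intro mult_mono) auto
  moreover have "c * (real i * (real i + 3) * c ^ i / (c * z)) + c ^ i * ((real i + 3) / z)
      = (real i + 1) * (real i + 3) * c ^ i / z"
    using c z by (simp add: field_simps)
  moreover have "(real i + 1) * (real i + 3) * c ^ i / z
      \<le> (real i + 1) * (real (Suc i) + 3) * c ^ i / z"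
    using c z by (intro divide_right_mono mult_right_mono mult_left_mono) auto
  moreover have "(real i + 1) * (real (Suc i) + 3) * c ^ i / z
      = real (Suc i) * (real (Suc i) + 3) * c ^ Suc i / (c * z)"
    using c z by (simp add: field_simps)
  ultimately have "c ^ Suc i - P (Suc i) \<le> real (Suc i) * (real (Suc i) + 3) * c ^ Suc i / (c * z)"
    using e by linarith
  moreover have "0 \<le> c ^ Suc i - P (Suc i)"
    unfolding e using Suc.IH P0 gap0 c by (intro add_nonneg_nonneg mult_nonneg_nonneg) auto
  ultimately show ?case unfolding z_def by simp
qed

text \<open>
  The factors \<open>c ^ i\<close> make the termwise errors summable, and \<open>(2 - c) / (1 - c)\<^sup>2\<close> is the sum of
  the series with terms \<open>(2 + i) c ^ i\<close>.
\<close>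

lemma run_sum_approx:
  fixes c :: real
  assumes c: "0 < c" "c < 1"
  obtains K where "\<And>n N. c * real n = real (Suc (Suc N)) \<Longrightarrow>
     \<bar>(2 - c) / (1 - c)\<^sup>2 - run_sum N n\<bar> \<le> K / (real n + 1)"
proof -
  define h where "h i = (2 + real i) * (real i * (real i + 3) * c ^ i / c)" for i
  \<comment> \<open>any ratio strictly between \<open>c\<close> and \<open>1\<close> absorbs the polynomial factor\<close>
  have "summable h"
  proof (rule summable_comparison_test_bigo)
    show "summable (\<lambda>i. norm (((1 + c) / 2) ^ i))"
      using c by (simp add: summable_geometric)
    show "h \<in> O(\<lambda>i. ((1 + c) / 2) ^ i)"
      unfolding h_def using c by real_asymp
  qed
  have lim: "(\<lambda>i. (2 + real i) * c ^ i) sums ((2 - c) / (1 - c)\<^sup>2)"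
  proof -
    have "(\<lambda>i. real (Suc i) * c ^ i + c ^ i) sums (1 / (1 - c)\<^sup>2 + 1 / (1 - c))"
      using geometric_deriv_sums[of c] geometric_sums[of c] c by (intro sums_add) auto
    moreover have "1 / (1 - c)\<^sup>2 + 1 / (1 - c) = (2 - c) / (1 - c)\<^sup>2"
    proof -
      define v where "v = 1 - c"
      have "v \<noteq> 0" "2 - c = 1 + v" using c by (auto simp: v_def)
      thus ?thesis unfolding v_def[symmetric] by (simp add: field_simps power2_eq_square)
    qed
    ultimately show ?thesis by (simp add: algebra_simps)
  qed
  have "\<bar>(2 - c) / (1 - c)\<^sup>2 - run_sum N n\<bar> \<le> suminf h / (real n + 1)"
    if N: "c * real n = real (Suc (Suc N))" for n N
  proof -
    define P where "P i = (\<Prod>t<i. (real N - real t) / (real n + 1))" for i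
    note bound = run_factor_approx[OF c N, folded P_def]
    have "(\<lambda>i. P i * (2 + real i)) sums run_sum N n"
      unfolding run_sum_def P_def[symmetric]
    proof (rule sums_finite)
      fix i assume "i \<notin> {..N}"
      hence "P i = 0" unfolding P_def by (intro prod_zero) (auto intro!: bexI[of _ N])
      thus "P i * (2 + real i) = 0" by simp
    qed simp
    from sums_diff[OF lim this]
    have d: "(\<lambda>i. (2 + real i) * (c ^ i - P i)) sums ((2 - c) / (1 - c)\<^sup>2 - run_sum N n)"
      by (simp add: algebra_simps)
    have nonneg: "0 \<le> (2 - c) / (1 - c)\<^sup>2 - run_sum N n"
      by (rule sums_le[OF _ sums_zero d]) (use bound in auto)
    have "(2 - c) / (1 - c)\<^sup>2 - run_sum N n \<le> suminf h / (real n + 1)"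
    proof (rule sums_le[OF _ d sums_divide[OF summable_sums[OF \<open>summable h\<close>]]])
      fix i
      have "(2 + real i) * (c ^ i - P i)
          \<le> (2 + real i) * (real i * (real i + 3) * c ^ i / (c * (real n + 1)))"
        using bound[of i] by (intro mult_left_mono) auto
      thus "(2 + real i) * (c ^ i - P i) \<le> h i / (real n + 1)" by (simp add: h_def)
    qed
    with nonneg show ?thesis by simp
  qed
  thus ?thesis by (rule that)
qed

text \<open>
  The rational main term, with \<open>u = 1 - c\<close> and the limit of \<open>run_sum\<close> inserted. Over the common
  denominator, of degree three in \<open>x\<close>, the cubic and quadratic coefficients of the numerator cancel.
\<close>

lemma rational_expansion:
  fixes u x :: real
  assumes u: "0 < u" "u < 1" and x: "x \<ge> 1"
  shows "\<bar>((1 - u) * x - 1) / (2 * (u * x + 1)) * (1 - (1 + u) / u\<^sup>2 / (x + 1))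
           - (1 - u) / (2 * u) - 1 / x * ((u\<^sup>2 - u - 1) / (2 * u ^ 3))\<bar> \<le> 3 / u ^ 4 * (1 / x\<^sup>2)"
proof -
  have pos: "u * x + 1 > 0" "x + 1 > 0" "x > 0" using u x by (auto intro: add_pos_pos)
  have u2: "u\<^sup>2 < 1" "u ^ 3 < 1" using u by (auto intro: power_less_one_iff[THEN iffD2])
  have u3: "u ^ 3 > 0" using u by simp
  have "((1 - u) * x - 1) / (2 * (u * x + 1)) * (1 - (1 + u) / u\<^sup>2 / (x + 1))
           - (1 - u) / (2 * u) - 1 / x * ((u\<^sup>2 - u - 1) / (2 * u ^ 3))
      = ((3 * u + 1 - u ^ 3) * x + (1 + u - u\<^sup>2)) / (2 * u ^ 3 * x * (u * x + 1) * (x + 1))"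
    using pos u by (simp add: divide_simps power2_eq_square power3_eq_cube) algebra
  also have "\<bar>\<dots>\<bar> \<le> (4 * x + 2) / (2 * u ^ 3 * x * (u * x) * x)"
  proof -
    have a: "0 \<le> (3 * u + 1 - u ^ 3) * x + (1 + u - u\<^sup>2)"
    proof -
      have "0 \<le> 3 * u + 1 - u ^ 3" "0 \<le> 1 + u - u\<^sup>2" using u u2 by linarith+
      thus ?thesis using x by simp
    qed
    have b: "(3 * u + 1 - u ^ 3) * x + (1 + u - u\<^sup>2) \<le> 4 * x + 2"
    proof -
      have "3 * u + 1 - u ^ 3 \<le> 4" "1 + u - u\<^sup>2 \<le> 2" using u u3 zero_le_power2[of u] by linarith+
      thus ?thesis using x by (intro add_mono mult_right_mono) auto
    qed
    have d: "2 * u ^ 3 * x * (u * x) * x \<le> 2 * u ^ 3 * x * (u * x + 1) * (x + 1)"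
      using u x by (intro mult_mono) auto
    have d0: "0 < 2 * u ^ 3 * x * (u * x) * x" using u x by simp
    show ?thesis using a b d d0 by (simp add: abs_of_nonneg frac_le)
  qed
  also have "\<dots> \<le> (6 * x) / (2 * u ^ 3 * x * (u * x) * x)"
    using u x by (intro divide_right_mono) auto
  also have "\<dots> = 3 / u ^ 4 * (1 / x\<^sup>2)"
    using u x by (simp add: field_simps power2_eq_square eval_nat_numeral)
  finally show ?thesis .
qed

theorem proposition2p12:
  fixes c p :: real
  assumes "0 < c" and "c < 1" and "0 \<le> p" and "p \<le> 1"
  shows "(\<lambda>n. expected_last_preference (nat \<lfloor>c * real n\<rfloor>) n p
            - ((real n + 1) / 2
               - (2 * p - 1) * (c / (2 * (1 - c)))
               - 1 / real n * (2 * p - 1) * ((c\<^sup>2 - c - 1) / (2 * (1 - c) ^ 3))))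
         \<in> O[inf at_top (principal {n. c * real n \<in> \<nat>})](\<lambda>n. 1 / real n ^ 2)"
proof -
  define u where "u = 1 - c"
  have u: "0 < u" "u < 1" and c_u: "c = 1 - u" using assms by (auto simp: u_def)
  obtain K where K: "\<And>n N. c * real n = real (Suc (Suc N)) \<Longrightarrow>
      \<bar>(2 - c) / (1 - c)\<^sup>2 - run_sum N n\<bar> \<le> K / (real n + 1)"
    using run_sum_approx[OF assms(1,2)] by blast
  have "\<forall>\<^sub>F n in at_top. c * real n \<in> \<nat> \<longrightarrow>
     norm (expected_last_preference (nat \<lfloor>c * real n\<rfloor>) n p
            - ((real n + 1) / 2
               - (2 * p - 1) * (c / (2 * (1 - c)))
               - 1 / real n * (2 * p - 1) * ((c\<^sup>2 - c - 1) / (2 * (1 - c) ^ 3))))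
      \<le> (\<bar>2 * p - 1\<bar> * (3 / u ^ 4 + c / (2 * u) * K)) * norm (1 / real n ^ 2)"
    \<comment> \<open>the bound ensures \<open>c n \<ge> 2\<close>, so that at least two cars arrive\<close>
    using eventually_ge_at_top[of "Suc (nat \<lceil>2 / c\<rceil>)"]
  proof eventually_elim
    case (elim n)
    show ?case
    proof
      assume "c * real n \<in> \<nat>"
      then obtain m where m: "c * real n = real m" by (auto elim: Nats_cases)
      have n: "real n \<ge> 1" using elim by simp
      have "2 / c \<le> real n" using elim by linarith
      hence "2 \<le> real m" using assms(1) by (simp add: m[symmetric] field_simps)
      then obtain N where N: "m = Suc (Suc N)"
        by (metis One_nat_def Suc_1 Suc_le_D of_nat_le_iff of_nat_numeral le_Suc_ex add_Suc add_2_eq_Suc)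
      have "real m \<le> 1 * real n"
        unfolding m[symmetric] using assms by (intro mult_right_mono) auto
      hence mn: "Suc (Suc N) \<le> n" using N by simp
      have fl: "nat \<lfloor>c * real n\<rfloor> = Suc (Suc N)" by (simp add: m N)
      have SN: "real (Suc N) = (1 - u) * real n - 1" using m N c_u by simp
      define D where "D = real n - real (Suc N)"
      have D: "D = u * real n + 1" unfolding D_def SN by (simp add: algebra_simps)
      have Dpos: "D > 0" using u n unfolding D by (intro add_nonneg_pos) auto
      define b where "b = (2 - c) / (1 - c)\<^sup>2"
      have b: "b = (1 + u) / u\<^sup>2" by (simp add: b_def c_u)
      define e where "e = b - run_sum N n"
      have e: "\<bar>e\<bar> \<le> K / (real n + 1)" using K[of n N] m N by (simp add: e_def b_def)
      \<comment> \<open>\<open>G\<close> is the error with the limit \<open>b\<close> in place of \<open>run_sum\<close>, and \<open>Q\<close> the effect of that exchange;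
        the prefactor \<open>1 / (n + 1)\<close> of \<open>run_sum\<close> makes an error of order \<open>1 / n\<close> there harmless.\<close>
      define G where "G = real (Suc N) / (2 * D) * (1 - b / (real n + 1))
           - c / (2 * (1 - c)) - 1 / real n * ((c\<^sup>2 - c - 1) / (2 * (1 - c) ^ 3))"
      define Q where "Q = real (Suc N) / (2 * D) * (e / (real n + 1))"
      have G: "\<bar>G\<bar> \<le> 3 / u ^ 4 * (1 / (real n)\<^sup>2)"
      proof -
        have sq: "c\<^sup>2 - c - 1 = u\<^sup>2 - u - 1"
          unfolding c_u by (simp add: power2_eq_square algebra_simps)
        have lin: "c / (2 * u) = (1 - u) / (2 * u)" by (simp add: c_u)
        show ?thesis
          using rational_expansion[OF u n] unfolding G_def SN D b u_def[symmetric] sq lin .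
      qed
      have Q: "\<bar>Q\<bar> \<le> c / (2 * u) * (K / (real n)\<^sup>2)"
      proof -
        have "real (Suc N) / (2 * D) \<le> (c * real n) / (2 * (u * real n))"
          using u n c_u assms unfolding D SN by (intro frac_le) auto
        hence 1: "real (Suc N) / (2 * D) \<le> c / (2 * u)" using n by simp
        have K0: "0 \<le> K" using e n abs_ge_zero[of e]
          by (metis add_nonneg_pos divide_less_0_iff linorder_not_le of_nat_0_le_iff order_trans zero_less_one)
        have "\<bar>e\<bar> / (real n + 1) \<le> K / (real n + 1) / (real n + 1)"
          using e by (intro divide_right_mono) auto
        also have "\<dots> = K / ((real n + 1) * (real n + 1))" by simp
        also have "\<dots> \<le> K / (real n)\<^sup>2"
          unfolding power2_eq_square using K0 n by (intro divide_left_mono mult_mono) auto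
        finally have 2: "\<bar>e\<bar> / (real n + 1) \<le> K / (real n)\<^sup>2" .
        have "\<bar>Q\<bar> = real (Suc N) / (2 * D) * (\<bar>e\<bar> / (real n + 1))"
          using Dpos by (simp add: Q_def abs_mult)
        also have "\<dots> \<le> c / (2 * u) * (K / (real n)\<^sup>2)"
          using 1 2 u assms by (intro mult_mono) auto
        finally show ?thesis .
      qed
      have "expected_last_preference (nat \<lfloor>c * real n\<rfloor>) n p
            - ((real n + 1) / 2
               - (2 * p - 1) * (c / (2 * (1 - c)))
               - 1 / real n * (2 * p - 1) * ((c\<^sup>2 - c - 1) / (2 * (1 - c) ^ 3)))
          = - (2 * p - 1) * (G + Q)"
      proof -
        have "real (Suc N) / (2 * D) * (1 - run_sum N n / (real n + 1))
            = real (Suc N) / (2 * D) * (1 - b / (real n + 1)) + Q"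
          unfolding Q_def e_def by (simp add: diff_divide_distrib algebra_simps)
        moreover have "(h - k * y) - (h - k * C - r * k * E) = - k * ((g - C - r * E) + q)"
          if "y = g + q" for h k y C r E g q :: real
          using that by (simp add: algebra_simps)
        ultimately show ?thesis
          unfolding fl expected_last_preference_exact[OF assms(3,4) mn] D_def[symmetric] G_def
          by blast
      qed
      hence "norm (expected_last_preference (nat \<lfloor>c * real n\<rfloor>) n p
            - ((real n + 1) / 2
               - (2 * p - 1) * (c / (2 * (1 - c)))
               - 1 / real n * (2 * p - 1) * ((c\<^sup>2 - c - 1) / (2 * (1 - c) ^ 3))))
          = \<bar>2 * p - 1\<bar> * \<bar>G + Q\<bar>"
        by (simp only: real_norm_def abs_mult abs_minus_cancel)
      also have "\<dots> \<le> \<bar>2 * p - 1\<bar> * (3 / u ^ 4 * (1 / (real n)\<^sup>2) + c / (2 * u) * (K / (real n)\<^sup>2))"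
        using G Q abs_triangle_ineq[of G Q] by (intro mult_left_mono) auto
      also have "\<dots> = (\<bar>2 * p - 1\<bar> * (3 / u ^ 4 + c / (2 * u) * K)) * norm (1 / real n ^ 2)"
        by (simp add: algebra_simps add_divide_distrib)
      finally show "norm (expected_last_preference (nat \<lfloor>c * real n\<rfloor>) n p
            - ((real n + 1) / 2
               - (2 * p - 1) * (c / (2 * (1 - c)))
               - 1 / real n * (2 * p - 1) * ((c\<^sup>2 - c - 1) / (2 * (1 - c) ^ 3))))
          \<le> (\<bar>2 * p - 1\<bar> * (3 / u ^ 4 + c / (2 * u) * K)) * norm (1 / real n ^ 2)" .
    qed
  qed
  thus ?thesis
    by (intro bigoI[of _ "\<bar>2 * p - 1\<bar> * (3 / u ^ 4 + c / (2 * u) * K)"])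
       (simp add: eventually_inf_principal)
qed

end
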